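(* Let $\gamma>-1/2$ and, for $p\in[0,p_c)$, let $\widetilde{\mathcal{G}}^{(p)}(t)=\sqrt{2(1-p)(\gamma+1)-1}\;\mathcal{G}^{(p)}(t)$, $t\ge0$, where $\mathcal{G}^{(p)}$ is the Gaussian process given in the context. Then the process $(\widetilde{\mathcal{G}}^{(p)}(t):t\ge0)$ is continuous in $p\in[0,p_c)$ under the topology of weak convergence, as processes in $C[0,\infty)$. Further, if a memory sequence $\{\mu_n\}$, regularly varying of index $\gamma$, is such that $\{v_n\}$ is unbounded for $p=p_c$, then, for a standard Gaussian random variable $Z$, as $p\uparrow p_c$, $$\left(\widetilde{\mathcal{G}}^{(p)}(t):t\ge0\right)\to\left(\sqrt t\,(2\gamma+1)Z:t\ge0\right)\quad\text{weakly in }C[0,\infty).$$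
   Context: $p_c=(\gamma+\frac12)/(\gamma+1)$, $\widehat p=\gamma/(\gamma+1)$. $(\mathcal{G}^{(p)}(t))_{t\ge0}$ is the continuous centered Gaussian process starting at $0$ with covariance kernel, for $0\le s\le t$, $$\mathbb{E}(\mathcal{G}^{(p)}(s)\mathcal{G}^{(p)}(t))=\begin{cases}\dfrac{s}{(1-p)(\gamma-p(\gamma+1))}\left(\gamma-\dfrac{p\,((2-p)(\gamma+1)-1)}{2(1-p)(\gamma+1)-1}\left(\dfrac st\right)^{\gamma-p(\gamma+1)}\right), & p\ne\widehat p,\\[3mm] s\left(\gamma^2+(\gamma+1)^2-\gamma(\gamma+1)\log\dfrac st\right), & p=\widehat p,\end{cases}$$ with value $0$ when $s=0$. $C[0,\infty)$ is the space of continuous real functions on $[0,\infty)$ with the topology of uniform convergence on compact sets. A memory sequence of index $\gamma$ is a sequence of positive reals with $\mu_{\lfloor\lambda n\rfloor}/\mu_n\to\lambda^\gamma$ for every $\lambda>0$; $\nu_n=\sum_{k=1}^n\mu_k$; for a given $p$, $a_n=\prod_{i=1}^{n-1}\left(1+p\frac{\mu_{i+1}}{\nu_i}\right)^{-1}$ for $n\ge1$ (so $a_1=1$) and $v_n^2=\sum_{k=1}^na_k^2\mu_k^2$ ($v_n\ge0$). *)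

theory Defs
  imports "HOL-Probability.Probability"
begin

(* C[0,oo). Paths are extensional on {0..}, so that two elements are equal as soon as they
   agree on [0,oo). *)
typedef halfline_path = "{f :: real \<Rightarrow> real. f \<in> extensional {0..} \<and> continuous_on {0..} f}"
  morphisms path_fun Path
proof
  have "continuous_on {0..} (restrict (\<lambda>_. 0 :: real) {0 :: real..})"
    by (rule continuous_on_eq[of _ "\<lambda>_. 0"]) auto
  then show "restrict (\<lambda>_. 0) {0..} \<in> {f :: real \<Rightarrow> real. f \<in> extensional {0..} \<and> continuous_on {0..} f}"
    by simp
qed

(* Topology of uniform convergence on compact sets; every compact subset of [0,oo) lies in
   some {0..T}, so these intervals suffice. *)
instantiation halfline_path :: topological_space
begin

definition open_halfline_path :: "halfline_path set \<Rightarrow> bool" where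
  "open_halfline_path U \<longleftrightarrow>
     (\<forall>f\<in>U. \<exists>T\<ge>0. \<exists>\<epsilon>>0. \<forall>g.
        (\<forall>t\<in>{0..T}. \<bar>path_fun g t - path_fun f t\<bar> < \<epsilon>) \<longrightarrow> g \<in> U)"

instance
proof
  show "open (UNIV :: halfline_path set)"
    unfolding open_halfline_path_def by (auto intro: exI[of _ 0] exI[of _ 1])
next
  fix S U :: "halfline_path set"
  assume S: "open S" and U: "open U"
  show "open (S \<inter> U)"
    unfolding open_halfline_path_def
  proof
    fix f assume f: "f \<in> S \<inter> U"
    obtain T1 e1 where 1: "T1 \<ge> 0" "e1 > 0"
      "\<And>g. (\<forall>t\<in>{0..T1}. \<bar>path_fun g t - path_fun f t\<bar> < e1) \<Longrightarrow> g \<in> S"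
      using S f unfolding open_halfline_path_def by blast
    obtain T2 e2 where 2: "T2 \<ge> 0" "e2 > 0"
      "\<And>g. (\<forall>t\<in>{0..T2}. \<bar>path_fun g t - path_fun f t\<bar> < e2) \<Longrightarrow> g \<in> U"
      using U f unfolding open_halfline_path_def by blast
    have "\<forall>g. (\<forall>t\<in>{0..max T1 T2}. \<bar>path_fun g t - path_fun f t\<bar> < min e1 e2) \<longrightarrow> g \<in> S \<inter> U"
      by (auto intro!: 1(3) 2(3))
    then show "\<exists>T\<ge>0. \<exists>\<epsilon>>0. \<forall>g.
        (\<forall>t\<in>{0..T}. \<bar>path_fun g t - path_fun f t\<bar> < \<epsilon>) \<longrightarrow> g \<in> S \<inter> U"
      using 1(1,2) 2(1,2) by (intro exI[of _ "max T1 T2"] exI[of _ "min e1 e2"] conjI) auto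
  qed
next
  fix K :: "halfline_path set set"
  assume K: "\<forall>S\<in>K. open S"
  show "open (\<Union>K)"
    unfolding open_halfline_path_def
  proof
    fix f assume "f \<in> \<Union>K"
    then obtain S where S: "S \<in> K" "f \<in> S" by blast
    then obtain T e where "T \<ge> 0" "e > 0"
      "\<forall>g. (\<forall>t\<in>{0..T}. \<bar>path_fun g t - path_fun f t\<bar> < e) \<longrightarrow> g \<in> S"
      using K unfolding open_halfline_path_def by blast
    with S show "\<exists>T\<ge>0. \<exists>\<epsilon>>0. \<forall>g.
        (\<forall>t\<in>{0..T}. \<bar>path_fun g t - path_fun f t\<bar> < \<epsilon>) \<longrightarrow> g \<in> \<Union>K"
      by (intro exI[of _ T] exI[of _ e] conjI) auto
  qed
qed

end

(* Law on C[0,oo) of a process all of whose sample paths are continuous on [0,oo). *)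
definition path_law :: "'a measure \<Rightarrow> (real \<Rightarrow> 'a \<Rightarrow> real) \<Rightarrow> halfline_path measure" where
  "path_law M X = distr M borel (\<lambda>\<omega>. Path (restrict (\<lambda>t. X t \<omega>) {0..}))"

definition weak_conv_to ::
    "('i \<Rightarrow> 'b :: topological_space measure) \<Rightarrow> 'b measure \<Rightarrow> 'i filter \<Rightarrow> bool" where
  "weak_conv_to P Q F \<longleftrightarrow>
     (\<forall>f :: 'b \<Rightarrow> real. continuous_on UNIV f \<and> bounded (range f) \<longrightarrow>
        ((\<lambda>i. integral\<^sup>L (P i) f) \<longlongrightarrow> integral\<^sup>L Q f) F)"

(* normal_density requires a positive standard deviation, so the degenerate law N(0,0) is
   listed separately. *)
definition centered_gaussian :: "'a measure \<Rightarrow> ('a \<Rightarrow> real) \<Rightarrow> bool" where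
  "centered_gaussian M Y \<longleftrightarrow>
     Y \<in> borel_measurable M \<and>
     ((\<exists>\<sigma>>0. distributed M lborel Y (normal_density 0 \<sigma>)) \<or> (AE \<omega> in M. Y \<omega> = 0))"

definition centered_gaussian_process :: "'a measure \<Rightarrow> (real \<Rightarrow> 'a \<Rightarrow> real) \<Rightarrow> bool" where
  "centered_gaussian_process M X \<longleftrightarrow>
     prob_space M \<and> (\<forall>t\<ge>0. X t \<in> borel_measurable M) \<and>
     (\<forall>I c. finite I \<and> I \<subseteq> {0..} \<longrightarrow> centered_gaussian M (\<lambda>\<omega>. \<Sum>t\<in>I. c t * X t \<omega>))"

definition p_crit :: "real \<Rightarrow> real" where
  "p_crit \<gamma> = (\<gamma> + 1/2) / (\<gamma> + 1)"

definition p_hat :: "real \<Rightarrow> real" where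
  "p_hat \<gamma> = \<gamma> / (\<gamma> + 1)"

(* Only meant for 0 \<le> s \<le> t. *)
definition cov_kernel :: "real \<Rightarrow> real \<Rightarrow> real \<Rightarrow> real \<Rightarrow> real" where
  "cov_kernel \<gamma> p s t =
     (if s = 0 then 0
      else if p \<noteq> p_hat \<gamma> then
        s / ((1 - p) * (\<gamma> - p * (\<gamma> + 1))) *
          (\<gamma> - p * ((2 - p) * (\<gamma> + 1) - 1) / (2 * (1 - p) * (\<gamma> + 1) - 1) *
            (s / t) powr (\<gamma> - p * (\<gamma> + 1)))
      else s * (\<gamma>\<^sup>2 + (\<gamma> + 1)\<^sup>2 - \<gamma> * (\<gamma> + 1) * ln (s / t)))"

definition is_G_process :: "real \<Rightarrow> real \<Rightarrow> 'a measure \<Rightarrow> (real \<Rightarrow> 'a \<Rightarrow> real) \<Rightarrow> bool" where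
  "is_G_process \<gamma> p M X \<longleftrightarrow>
     centered_gaussian_process M X \<and>
     (\<forall>\<omega>\<in>space M. X 0 \<omega> = 0 \<and> continuous_on {0..} (\<lambda>t. X t \<omega>)) \<and>
     (\<forall>s t. 0 \<le> s \<and> s \<le> t \<longrightarrow> integral\<^sup>L M (\<lambda>\<omega>. X s \<omega> * X t \<omega>) = cov_kernel \<gamma> p s t)"

definition rescaled_process :: "real \<Rightarrow> real \<Rightarrow> (real \<Rightarrow> 'a \<Rightarrow> real) \<Rightarrow> real \<Rightarrow> 'a \<Rightarrow> real" where
  "rescaled_process \<gamma> p X t \<omega> = sqrt (2 * (1 - p) * (\<gamma> + 1) - 1) * X t \<omega>"

(* Sequences are indexed from 1; the value at 0 plays no role. *)
definition memory_sequence :: "real \<Rightarrow> (nat \<Rightarrow> real) \<Rightarrow> bool" where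
  "memory_sequence \<gamma> \<mu> \<longleftrightarrow>
     (\<forall>n\<ge>1. \<mu> n > 0) \<and>
     (\<forall>r>0. (\<lambda>n. \<mu> (nat \<lfloor>r * real n\<rfloor>) / \<mu> n) \<longlonglongrightarrow> r powr \<gamma>)"

definition mem_nu :: "(nat \<Rightarrow> real) \<Rightarrow> nat \<Rightarrow> real" where
  "mem_nu \<mu> n = (\<Sum>k=1..n. \<mu> k)"

definition mem_a :: "real \<Rightarrow> (nat \<Rightarrow> real) \<Rightarrow> nat \<Rightarrow> real" where
  "mem_a p \<mu> n = (\<Prod>i\<in>{1..<n}. inverse (1 + p * (\<mu> (i + 1) / mem_nu \<mu> i)))"

definition mem_v :: "real \<Rightarrow> (nat \<Rightarrow> real) \<Rightarrow> nat \<Rightarrow> real" where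
  "mem_v p \<mu> n = sqrt (\<Sum>k=1..n. (mem_a p \<mu> k)\<^sup>2 * (\<mu> k)\<^sup>2)"

end

theory Submission
  imports Defs
begin

text \<open>
  Multiplied by 2(1-p)(\<gamma>+1)-1, the covariance kernel extends continuously in p to [0,1), across
  the apparent singularity at p_hat and up to p_crit, where it equals (2\<gamma>+1)^2 sqrt(st). Moreover
  the increments satisfy E(X_t-X_s)^2 \<le> 2(\<gamma>+1)(2\<gamma>+1)(t-s) uniformly in p. For centered Gaussian
  processes, convergence of the covariances together with such a bound yields weak convergence
  on paths, and this is shown without Prokhorov's theorem. A bounded continuous functional is an
  increasing limit of bounded functionals that are Lipschitz for the sup-norm on some [0,n], so the
  latter suffice. For a Lipschitz functional a path may be replaced by its dyadic linear
  interpolation, with an error that is uniform in p by a fourth-moment chaining bound. This leaves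
  convergence of Gaussian vectors, which follows from Stone-Weierstrass, because the expectation of
  a trigonometric polynomial is an explicit function of the covariances.
\<close>

subsection \<open>Lipschitz functionals of paths\<close>

text \<open>The path space is known only as a topological space, and the processes for different p
  live on unrelated probability spaces, so all comparisons are between expectations of functionals.
  The sup-norm Lipschitz ones also give Borel measurability of path maps, since indicators of open
  sets are limits of such functionals. An increment variance of order t - s is by itself too weak
  for chaining. Gaussianity turns it into a fourth moment of order (t - s)^2, so that the roughly
  2^j increments of level j contribute only 2^-j in total. Both apparent singularities of the kernel
  are removed by one identity. Put c = 2(1-p)(\<gamma>+1) - 1, d = \<gamma> - p(\<gamma>+1), B =
  p((2-p)(\<gamma>+1) - 1) and r = s/t. Multiplication by c clears the pole at p_crit, and c\<gamma>
  - B = d(2\<gamma>+1-p) leaves d only in (1 - r^d)/d, which tends to -ln r as d tends to 0.\<close>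

lemma path_fun_continuous: "continuous_on {0..} (path_fun x)"
  using path_fun[of x] by simp

lemma path_fun_Path_restrict:
  assumes "continuous_on {0..} f" "0 \<le> t"
  shows "path_fun (Path (restrict f {0..})) t = f t"
proof -
  have "continuous_on {0..} (restrict f {0..})"
    using assms(1) by (rule continuous_on_eq) simp
  then show ?thesis
    using assms(2) by (simp add: Path_inverse)
qed

text \<open>A bound e is carried along instead of the supremum itself, so that no boundedness of
  suprema has to be discussed and the triangle inequality is pointwise.\<close>

definition close_upto :: "nat \<Rightarrow> real \<Rightarrow> halfline_path \<Rightarrow> halfline_path \<Rightarrow> bool" where
  "close_upto n e x y \<longleftrightarrow> (\<forall>t\<in>{0..real n}. \<bar>path_fun x t - path_fun y t\<bar> \<le> e)"

text \<open>One index n serves as time horizon and as Lipschitz constant: both have to grow in the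
  approximation by \<open>lower_env\<close>.\<close>

definition lipschitz_upto :: "nat \<Rightarrow> (halfline_path \<Rightarrow> real) \<Rightarrow> bool" where
  "lipschitz_upto n g \<longleftrightarrow> (\<forall>x y e. close_upto n e x y \<longrightarrow> \<bar>g x - g y\<bar> \<le> real n * e)"

lemma close_upto_refl: "close_upto n 0 x x"
  by (simp add: close_upto_def)

lemma close_upto_sym: "close_upto n e x y \<Longrightarrow> close_upto n e y x"
  by (simp add: close_upto_def abs_minus_commute)

lemma close_upto_trans:
  assumes "close_upto n d x y" "close_upto n e y z"
  shows "close_upto n (d + e) x z"
  unfolding close_upto_def
proof
  fix t assume "t \<in> {0..real n}"
  then have "\<bar>path_fun x t - path_fun y t\<bar> \<le> d" "\<bar>path_fun y t - path_fun z t\<bar> \<le> e"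
    using assms unfolding close_upto_def by blast+
  then show "\<bar>path_fun x t - path_fun z t\<bar> \<le> d + e" by linarith
qed

lemma close_upto_nonneg: "close_upto n e x y \<Longrightarrow> 0 \<le> e"
  unfolding close_upto_def by (force dest: bspec[of _ _ 0])

(* The inf-convolution of f with n times the sup-seminorm on [0,n]. *)
definition lower_env :: "nat \<Rightarrow> (halfline_path \<Rightarrow> real) \<Rightarrow> halfline_path \<Rightarrow> real" where
  "lower_env n f x = Inf {f y + real n * e | y e. close_upto n e x y}"

context
  fixes f :: "halfline_path \<Rightarrow> real" and b :: real
  assumes bound: "\<And>x. \<bar>f x\<bar> \<le> b"
begin

lemma lower_env_below: "close_upto n e x y \<Longrightarrow> lower_env n f x \<le> f y + real n * e"
  unfolding lower_env_def
proof (rule cInf_lower)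
  show "bdd_below {f y + real n * e | y e. close_upto n e x y}"
  proof (rule bdd_belowI[of _ "- b"])
    fix z assume "z \<in> {f y + real n * e | y e. close_upto n e x y}"
    then obtain y e where z: "z = f y + real n * e" "close_upto n e x y" by blast
    with close_upto_nonneg[OF z(2)] have "0 \<le> real n * e" by simp
    then show "- b \<le> z" using bound[of y] z(1) by linarith
  qed
qed auto

lemma lower_env_greatest:
  assumes "\<And>y e. close_upto n e x y \<Longrightarrow> a \<le> f y + real n * e"
  shows "a \<le> lower_env n f x"
  unfolding lower_env_def
  by (rule cInf_greatest) (use close_upto_refl assms in blast)+

lemma lower_env_le: "lower_env n f x \<le> f x"
  using lower_env_below[OF close_upto_refl] by simp

lemma lower_env_bound: "\<bar>lower_env n f x\<bar> \<le> b"
proof -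
  have "- b \<le> lower_env n f x"
  proof (rule lower_env_greatest)
    fix y e assume "close_upto n e x y"
    then have "0 \<le> real n * e" by (simp add: close_upto_nonneg)
    then show "- b \<le> f y + real n * e" using bound[of y] by linarith
  qed
  moreover have "lower_env n f x \<le> b"
    using lower_env_le[of n x] bound[of x] by linarith
  ultimately show ?thesis by linarith
qed

text \<open>By the triangle inequality, a competitor (z, d) for y yields the competitor (z, e + d)
  for x.\<close>

lemma lower_env_lipschitz: "lipschitz_upto n (lower_env n f)"
proof -
  have le: "lower_env n f x \<le> lower_env n f y + real n * e" if "close_upto n e x y" for x y e
  proof -
    have "lower_env n f x - real n * e \<le> lower_env n f y"
    proof (rule lower_env_greatest)
      fix z d assume "close_upto n d y z"
      from lower_env_below[OF close_upto_trans[OF that this]]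
      show "lower_env n f x - real n * e \<le> f z + real n * d"
        by (simp add: algebra_simps)
    qed
    then show ?thesis by simp
  qed
  then show ?thesis
    unfolding lipschitz_upto_def
    by (metis abs_le_iff add.commute close_upto_sym diff_le_eq minus_diff_eq)
qed

text \<open>Paths near x have values above f x - r/2 by lower semicontinuity, and all others pay a
  penalty exceeding the oscillation of f. Semicontinuity rather than continuity is assumed so that
  indicators of open sets are covered.\<close>

lemma lower_env_tendsto:
  assumes lsc: "\<And>a. open {x. a < f x}"
  shows "(\<lambda>n. lower_env n f x) \<longlonglongrightarrow> f x"
proof (rule LIMSEQ_I)
  fix r :: real assume r: "0 < r"
  have "x \<in> {z. f x - r / 2 < f z}" using r by simp
  then obtain T \<delta> where T: "T \<ge> 0" "\<delta> > 0"
    and near: "\<And>y. (\<forall>t\<in>{0..T}. \<bar>path_fun y t - path_fun x t\<bar> < \<delta>) \<Longrightarrow> f x - r / 2 < f y"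
    using lsc[of "f x - r / 2"] unfolding open_halfline_path_def by blast
  have b: "0 \<le> b" using bound[of x] by linarith
  \<comment> \<open>From n0 on, [0,n] contains [0,T] and the penalty n * \<delta> is at least 2 *
    b.\<close>
  define n0 where "n0 = nat \<lceil>max T (2 * b / \<delta>)\<rceil>"
  have "norm (lower_env n f x - f x) < r" if "n \<ge> n0" for n
  proof -
    have n: "T \<le> real n" "2 * b / \<delta> \<le> real n"
      using that unfolding n0_def by linarith+
    have "f x - r / 2 \<le> lower_env n f x"
    proof (rule lower_env_greatest)
      fix y e assume c: "close_upto n e x y"
      have e: "0 \<le> real n * e" by (simp add: close_upto_nonneg[OF c])
      show "f x - r / 2 \<le> f y + real n * e"
      proof (cases "e < \<delta>")
        case True
        have "\<forall>t\<in>{0..T}. \<bar>path_fun y t - path_fun x t\<bar> < \<delta>"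
        proof
          fix t assume "t \<in> {0..T}"
          with n(1) have "t \<in> {0..real n}" by simp
          then have "\<bar>path_fun x t - path_fun y t\<bar> \<le> e"
            using c unfolding close_upto_def by blast
          then show "\<bar>path_fun y t - path_fun x t\<bar> < \<delta>" using True by linarith
        qed
        from near[OF this] e show ?thesis by linarith
      next
        case False
        have "2 * b \<le> real n * \<delta>" using n(2) T(2) by (simp add: field_simps)
        also have "\<dots> \<le> real n * e" using False by (simp add: mult_left_mono)
        finally show ?thesis using bound[of x] bound[of y] r by linarith
      qed
    qed
    then show ?thesis using lower_env_le[of n x] r by simp
  qed
  then show "\<exists>n0. \<forall>n\<ge>n0. norm (lower_env n f x - f x) < r" by blast
qed

end

subsection \<open>Piecewise linear interpolation of paths\<close>

text \<open>A sum of tent functions at the dyadic points k / 2^j. The nodes reach n + 1, one unit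
  beyond the interval of interest, so that every t in [0,n] has a right neighbour among them. The
  values z form an infinite sequence, so that the product topology on
  \<open>nat \<Rightarrow> real\<close> can be used for all levels at once.\<close>

definition hat_interp :: "nat \<Rightarrow> nat \<Rightarrow> (nat \<Rightarrow> real) \<Rightarrow> halfline_path" where
  "hat_interp n j z =
     Path (restrict (\<lambda>t. \<Sum>k\<le>Suc n * 2 ^ j. z k * max 0 (1 - \<bar>2 ^ j * t - real k\<bar>)) {0..})"

definition samples :: "nat \<Rightarrow> halfline_path \<Rightarrow> nat \<Rightarrow> real" where
  "samples j x k = path_fun x (real k / 2 ^ j)"

lemma path_fun_hat_interp:
  "0 \<le> t \<Longrightarrow> path_fun (hat_interp n j z) t =
     (\<Sum>k\<le>Suc n * 2 ^ j. z k * max 0 (1 - \<bar>2 ^ j * t - real k\<bar>))"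
  unfolding hat_interp_def
  by (rule path_fun_Path_restrict) (intro continuous_intros, simp)

lemma hat_interp_cong:
  assumes "\<And>k. k \<le> Suc n * 2 ^ j \<Longrightarrow> z k = z' k"
  shows "hat_interp n j z = hat_interp n j z'"
proof -
  have "(\<Sum>k\<le>Suc n * 2 ^ j. z k * max 0 (1 - \<bar>2 ^ j * t - real k\<bar>)) =
    (\<Sum>k\<le>Suc n * 2 ^ j. z' k * max 0 (1 - \<bar>2 ^ j * t - real k\<bar>))" for t :: real
    using assms by (intro sum.cong) simp_all
  then show ?thesis unfolding hat_interp_def by presburger
qed

lemma hat_interp_close:
  "close_upto n (\<Sum>k\<le>Suc n * 2 ^ j. \<bar>z k - z' k\<bar>) (hat_interp n j z) (hat_interp n j z')"
  unfolding close_upto_def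
proof
  fix t assume "t \<in> {0..real n}"
  then have "path_fun (hat_interp n j z) t - path_fun (hat_interp n j z') t =
     (\<Sum>k\<le>Suc n * 2 ^ j. (z k - z' k) * max 0 (1 - \<bar>2 ^ j * t - real k\<bar>))"
    by (simp add: path_fun_hat_interp sum_subtractf left_diff_distrib)
  also have "\<bar>\<dots>\<bar> \<le> (\<Sum>k\<le>Suc n * 2 ^ j. \<bar>(z k - z' k) * max 0 (1 - \<bar>2 ^ j * t - real k\<bar>)\<bar>)"
    by (rule sum_abs)
  also have "\<dots> \<le> (\<Sum>k\<le>Suc n * 2 ^ j. \<bar>z k - z' k\<bar>)"
    by (intro sum_mono) (simp add: abs_mult mult_left_le)
  finally show "\<bar>path_fun (hat_interp n j z) t - path_fun (hat_interp n j z') t\<bar> \<le> \<dots>" .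
qed

text \<open>By \<open>hat_interp_close\<close>, the functional changes by at most n times a finite
  sum of coordinate differences, which is continuous in the product topology.\<close>

lemma continuous_lipschitz_hat_interp:
  assumes "lipschitz_upto n g"
  shows "continuous_on UNIV (\<lambda>z. g (hat_interp n j z))"
proof -
  have "((\<lambda>z. g (hat_interp n j z)) \<longlongrightarrow> g (hat_interp n j z0)) (at z0)" for z0 :: "nat \<Rightarrow> real"
  proof (rule LIM_zero_cancel, rule Lim_null_comparison)
    let ?d = "\<lambda>z :: nat \<Rightarrow> real. real n * (\<Sum>k\<le>Suc n * 2 ^ j. \<bar>z k - z0 k\<bar>)"
    show "\<forall>\<^sub>F z in at z0. norm (g (hat_interp n j z) - g (hat_interp n j z0)) \<le> ?d z"
      using assms hat_interp_close unfolding lipschitz_upto_def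
      by (intro always_eventually allI) (metis real_norm_def)
    have "continuous_on UNIV ?d"
      by (intro continuous_intros continuous_on_product_coordinates)
    then have "(?d \<longlongrightarrow> ?d z0) (at z0)"
      unfolding continuous_on_def by blast
    moreover have "?d z0 = 0" by simp
    ultimately show "(?d \<longlongrightarrow> 0) (at z0)" by (simp only:)
  qed
  then show ?thesis by (simp add: continuous_on_def)
qed

lemma hat_interp_eval:
  fixes j n :: nat and t :: real
  assumes t: "0 \<le> t" "t \<le> real n"
  defines "k \<equiv> nat \<lfloor>2 ^ j * t\<rfloor>"
  defines "u \<equiv> 2 ^ j * t - real k"
  shows "path_fun (hat_interp n j z) t = (1 - u) * z k + u * z (Suc k)"
    and "0 \<le> u" "u \<le> 1" "Suc k \<le> Suc n * 2 ^ j"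
proof -
  have kt: "real k \<le> 2 ^ j * t" "2 ^ j * t < real k + 1"
    using t(1) unfolding k_def by (simp_all add: of_nat_nat)
  then show u: "0 \<le> u" "u \<le> 1" unfolding u_def by linarith+
  have "2 ^ j * t \<le> 2 ^ j * real n" using t(2) by (rule mult_left_mono) simp
  then have "real k \<le> real (n * 2 ^ j)" using kt(1)
    unfolding of_nat_mult of_nat_power of_nat_numeral by (simp only: mult.commute order.trans)
  then have "k \<le> n * 2 ^ j" by linarith
  moreover have "1 \<le> (2::nat) ^ j" by simp
  ultimately show k: "Suc k \<le> Suc n * 2 ^ j"
    using add_mono[of 1 "2 ^ j" k "n * 2 ^ j"] by simp
  \<comment> \<open>Only the tents at the two nodes around t are nonzero there.\<close>
  have zero: "max 0 (1 - \<bar>2 ^ j * t - real i\<bar>) = 0" if "i \<noteq> k" "i \<noteq> Suc k" for i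
  proof -
    have "i + 1 \<le> k \<or> k + 2 \<le> i" using that by linarith
    then have "real i + 1 \<le> real k \<or> real k + 2 \<le> real i" by linarith
    then show ?thesis using kt by linarith
  qed
  have "path_fun (hat_interp n j z) t =
      (\<Sum>i\<le>Suc n * 2 ^ j. z i * max 0 (1 - \<bar>2 ^ j * t - real i\<bar>))"
    using t(1) by (rule path_fun_hat_interp)
  also have "\<dots> = (\<Sum>i\<in>{k, Suc k}. z i * max 0 (1 - \<bar>2 ^ j * t - real i\<bar>))"
    using k zero by (intro sum.mono_neutral_right) auto
  also have "\<dots> = (1 - u) * z k + u * z (Suc k)"
    using u unfolding u_def by (simp add: algebra_simps)
  finally show "path_fun (hat_interp n j z) t = (1 - u) * z k + u * z (Suc k)" .
qed

lemma hat_interp_near_left: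
  fixes j n :: nat and t :: real
  assumes t: "0 \<le> t" "t \<le> real n"
  defines "k \<equiv> nat \<lfloor>2 ^ j * t\<rfloor>"
  shows "\<bar>path_fun (hat_interp n j z) t - z k\<bar> \<le> \<bar>z (Suc k) - z k\<bar>"
proof -
  define u where "u = 2 ^ j * t - real k"
  note h = hat_interp_eval[OF t, of j, folded k_def, folded u_def]
  have "path_fun (hat_interp n j z) t - z k = u * (z (Suc k) - z k)"
    unfolding h(1) by (simp add: algebra_simps)
  then show ?thesis using h(2,3) by (simp add: abs_mult mult_left_le_one_le)
qed

text \<open>Both interpolants are compared with the node to the left of t at their own level: this
  costs d at level j and d' at level j + 1. The fine left node is the coarse one or the next fine
  node after it, which costs another d'.\<close>

lemma hat_interp_step:
  assumes inc: "\<And>i. Suc i \<le> Suc n * 2 ^ j \<Longrightarrow> \<bar>samples j x (Suc i) - samples j x i\<bar> \<le> d"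
    and inc': "\<And>i. Suc i \<le> Suc n * 2 ^ Suc j \<Longrightarrow>
          \<bar>samples (Suc j) x (Suc i) - samples (Suc j) x i\<bar> \<le> d'"
  shows "close_upto n (d + 2 * d') (hat_interp n (Suc j) (samples (Suc j) x))
           (hat_interp n j (samples j x))"
  unfolding close_upto_def
proof
  fix t assume "t \<in> {0..real n}"
  then have t: "0 \<le> t" "t \<le> real n" by auto
  define k where "k = nat \<lfloor>2 ^ j * t\<rfloor>"
  define k' where "k' = nat \<lfloor>2 ^ Suc j * t\<rfloor>"
  have kt: "real k \<le> 2 ^ j * t" "2 ^ j * t < real k + 1"
    using t(1) unfolding k_def by (simp_all add: of_nat_nat)
  have kt': "real k' \<le> 2 * (2 ^ j * t)" "2 * (2 ^ j * t) < real k' + 1"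
  proof -
    have "real k' = real_of_int \<lfloor>2 ^ Suc j * t\<rfloor>"
      using t(1) unfolding k'_def by (intro of_nat_nat) simp
    then show "real k' \<le> 2 * (2 ^ j * t)" "2 * (2 ^ j * t) < real k' + 1"
      by (simp_all add: mult.assoc)
  qed
  have k'_cases: "k' = 2 * k \<or> k' = Suc (2 * k)"
    using kt kt' by linarith
  have half: "samples (Suc j) x (2 * i) = samples j x i" for i
    by (simp add: samples_def)
  note b = hat_interp_eval(4)[OF t, of j, folded k_def]
    and b' = hat_interp_eval(4)[OF t, of "Suc j", folded k'_def]
  have "\<bar>samples (Suc j) x k' - samples j x k\<bar> \<le> d'"
    using k'_cases
  proof
    assume "k' = 2 * k"
    then show ?thesis using order_trans[OF abs_ge_zero inc'[OF b']] half by simp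
  next
    assume k': "k' = Suc (2 * k)"
    have "Suc (2 * k) \<le> Suc n * 2 ^ Suc j" using b' k' by linarith
    from inc'[OF this] show ?thesis using k' half[of k] by simp
  qed
  moreover have "\<bar>path_fun (hat_interp n j (samples j x)) t - samples j x k\<bar> \<le> d"
    using hat_interp_near_left[OF t, of j "samples j x", folded k_def] inc[OF b] by linarith
  moreover have "\<bar>path_fun (hat_interp n (Suc j) (samples (Suc j) x)) t - samples (Suc j) x k'\<bar> \<le> d'"
    using hat_interp_near_left[OF t, of "Suc j" "samples (Suc j) x", folded k'_def] inc'[OF b']
    by linarith
  ultimately show "\<bar>path_fun (hat_interp n (Suc j) (samples (Suc j) x)) t -
      path_fun (hat_interp n j (samples j x)) t\<bar> \<le> d + 2 * d'" by linarith
qed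

lemma hat_interp_samples_tendsto:
  assumes "e > 0"
  shows "\<forall>\<^sub>F j in sequentially. close_upto n e (hat_interp n j (samples j x)) x"
proof -
  \<comment> \<open>The interval ends at n + 1 because the right node of a point t \<le> n may lie
    beyond n.\<close>
  have "uniformly_continuous_on {0..real (Suc n)} (path_fun x)"
    by (intro compact_uniformly_continuous continuous_on_subset[OF path_fun_continuous]) auto
  then obtain d where d: "d > 0"
    and uc: "\<And>s t. s \<in> {0..real (Suc n)} \<Longrightarrow> t \<in> {0..real (Suc n)} \<Longrightarrow> \<bar>s - t\<bar> < d \<Longrightarrow>
       \<bar>path_fun x s - path_fun x t\<bar> < e / 2"
    using assms unfolding uniformly_continuous_on_def dist_real_def
    by (metis half_gt_zero)
  have "(\<lambda>j. (1/2::real) ^ j) \<longlonglongrightarrow> 0" by (rule LIMSEQ_realpow_zero) auto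
  then have "\<forall>\<^sub>F j in sequentially. (1/2::real) ^ j < d"
    using d by (rule order_tendstoD)
  then show ?thesis
  proof eventually_elim
    case (elim j)
    show ?case
      unfolding close_upto_def
    proof
      fix t assume "t \<in> {0..real n}"
      then have t: "0 \<le> t" "t \<le> real n" by auto
      define k where "k = nat \<lfloor>2 ^ j * t\<rfloor>"
      have kt: "real k \<le> 2 ^ j * t" "2 ^ j * t < real k + 1"
        using t(1) unfolding k_def by (simp_all add: of_nat_nat)
      have step: "real (Suc k) / 2 ^ j = real k / 2 ^ j + (1/2) ^ j"
        by (simp add: field_simps power_divide)
      have lo: "real k / 2 ^ j \<le> t" and hi: "t \<le> real k / 2 ^ j + (1/2) ^ j"
        using kt by (simp_all add: field_simps power_divide)
      have one: "(1/2::real) ^ j \<le> 1" by (simp add: power_le_one)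
      have r: "real k / 2 ^ j \<in> {0..real (Suc n)}" "t \<in> {0..real (Suc n)}"
          "real (Suc k) / 2 ^ j \<in> {0..real (Suc n)}"
        using t lo step one by auto
      have "\<bar>samples j x k - path_fun x t\<bar> < e / 2"
        unfolding samples_def using uc[OF r(1,2)] lo hi elim by simp
      moreover have "\<bar>samples j x (Suc k) - samples j x k\<bar> < e / 2"
        unfolding samples_def using uc[OF r(3,1)] step elim by simp
      ultimately show "\<bar>path_fun (hat_interp n j (samples j x)) t - path_fun x t\<bar> \<le> e"
        using hat_interp_near_left[OF t, of j "samples j x", folded k_def] by linarith
    qed
  qed
qed

lemma lipschitz_hat_interp_tendsto:
  assumes "lipschitz_upto n g"
  shows "(\<lambda>j. g (hat_interp n j (samples j x))) \<longlonglongrightarrow> g x"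
proof (rule LIMSEQ_I)
  fix r :: real assume r: "0 < r"
  \<comment> \<open>The summand 1 covers n = 0 and makes n * e strictly smaller than r.\<close>
  define e where "e = r / (real n + 1)"
  have e: "e > 0" "real n * e < r" using r unfolding e_def by (simp_all add: field_simps)
  from hat_interp_samples_tendsto[OF e(1), of n x]
  have "\<forall>\<^sub>F j in sequentially. norm (g (hat_interp n j (samples j x)) - g x) < r"
  proof eventually_elim
    case (elim j)
    then have "\<bar>g (hat_interp n j (samples j x)) - g x\<bar> \<le> real n * e"
      using assms unfolding lipschitz_upto_def by blast
    then show ?case using e(2) by simp
  qed
  then show "\<exists>n0. \<forall>j\<ge>n0. norm (g (hat_interp n j (samples j x)) - g x) < r"
    by (simp add: eventually_sequentially)
qed

section \<open>Measurability of path-valued maps\<close>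

lemma measurable_lipschitz_path:
  fixes \<Phi> :: "'a \<Rightarrow> halfline_path"
  assumes coord: "\<And>t. 0 \<le> t \<Longrightarrow> (\<lambda>\<omega>. path_fun (\<Phi> \<omega>) t) \<in> borel_measurable M"
    and g: "lipschitz_upto n g"
  shows "(\<lambda>\<omega>. g (\<Phi> \<omega>)) \<in> borel_measurable M"
proof (rule borel_measurable_LIMSEQ_real)
  show "(\<lambda>j. g (hat_interp n j (samples j (\<Phi> \<omega>)))) \<longlonglongrightarrow> g (\<Phi> \<omega>)" for \<omega>
    by (rule lipschitz_hat_interp_tendsto[OF g])
  fix j
  have "(\<lambda>\<omega>. samples j (\<Phi> \<omega>)) \<in> borel_measurable M"
    unfolding samples_def by (intro measurable_coordinatewise_then_product coord) simp
  then show "(\<lambda>\<omega>. g (hat_interp n j (samples j (\<Phi> \<omega>)))) \<in> borel_measurable M"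
    by (rule measurable_compose)
      (intro borel_measurable_continuous_onI continuous_lipschitz_hat_interp g)
qed

text \<open>The coordinates generate the Borel sets: the indicator of an open set is lower
  semicontinuous, hence a pointwise limit of envelopes, and each envelope is a pointwise limit of
  continuous functions of finitely many samples.\<close>

lemma measurable_path:
  fixes \<Phi> :: "'a \<Rightarrow> halfline_path"
  assumes coord: "\<And>t. 0 \<le> t \<Longrightarrow> (\<lambda>\<omega>. path_fun (\<Phi> \<omega>) t) \<in> borel_measurable M"
  shows "\<Phi> \<in> borel_measurable M"
proof (rule borel_measurableI)
  fix U :: "halfline_path set" assume U: "open U"
  let ?f = "indicator U :: halfline_path \<Rightarrow> real"
  have bound: "\<bar>?f x\<bar> \<le> 1" for x by (simp add: indicator_def)
  have lsc: "open {x. a < ?f x}" for a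
  proof -
    have "{x. a < ?f x} = (if a < 0 then UNIV else if a < 1 then U else {})"
      by (auto simp: indicator_def split: if_splits)
    then show ?thesis using U by simp
  qed
  have "(\<lambda>\<omega>. ?f (\<Phi> \<omega>)) \<in> borel_measurable M"
  proof (rule borel_measurable_LIMSEQ_real)
    show "(\<lambda>n. lower_env n ?f (\<Phi> \<omega>)) \<longlonglongrightarrow> ?f (\<Phi> \<omega>)" for \<omega>
      by (rule lower_env_tendsto[OF bound lsc])
    show "(\<lambda>\<omega>. lower_env n ?f (\<Phi> \<omega>)) \<in> borel_measurable M" for n
      using coord by (rule measurable_lipschitz_path[OF _ lower_env_lipschitz[OF bound]])
  qed
  then have "(\<lambda>\<omega>. ?f (\<Phi> \<omega>)) -` {1} \<inter> space M \<in> sets M"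
    by (rule measurable_sets) simp
  moreover have "(\<lambda>\<omega>. ?f (\<Phi> \<omega>)) -` {1} \<inter> space M = \<Phi> -` U \<inter> space M"
    by (auto simp: indicator_def split: if_splits)
  ultimately show "\<Phi> -` U \<inter> space M \<in> sets M" by simp
qed

lemma continuous_path_eval:
  assumes t: "0 \<le> t"
  shows "continuous_on UNIV (\<lambda>x. path_fun x t)"
  unfolding continuous_on_open_vimage[OF open_UNIV]
proof (intro allI impI)
  fix A :: "real set" assume A: "open A"
  show "open ((\<lambda>x. path_fun x t) -` A \<inter> UNIV)"
    unfolding open_halfline_path_def
  proof
    fix x assume "x \<in> (\<lambda>x. path_fun x t) -` A \<inter> UNIV"
    then obtain e where "e > 0" "\<And>y. dist y (path_fun x t) < e \<Longrightarrow> y \<in> A"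
      using A by (auto simp: open_dist)
    with t show "\<exists>T\<ge>0. \<exists>\<epsilon>>0. \<forall>g. (\<forall>s\<in>{0..T}. \<bar>path_fun g s - path_fun x s\<bar> < \<epsilon>) \<longrightarrow>
        g \<in> (\<lambda>x. path_fun x t) -` A \<inter> UNIV"
      by (intro exI[of _ t] exI[of _ e] conjI) (auto simp: dist_real_def)
  qed
qed

lemma borel_measurable_lipschitz_upto:
  assumes "lipschitz_upto n g"
  shows "g \<in> borel_measurable borel"
  using assms
  by (rule measurable_lipschitz_path[where \<Phi> = "\<lambda>x. x", rotated])
     (intro borel_measurable_continuous_onI continuous_path_eval)

text \<open>Since the envelopes lie below f, the index n can be chosen from \<open>Q\<close> alone;
  on the side of \<open>P i\<close>, monotonicity of the integral suffices, so no tightness enters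
  here. This gives the lower bound, and the upper bound is the lower bound for -f.\<close>

lemma weak_conv_to_lipschitz:
  assumes P: "\<forall>\<^sub>F i in F. prob_space (P i) \<and> sets (P i) = sets borel"
    and Q: "prob_space Q" "sets Q = sets borel"
    and conv: "\<And>n b g. (\<And>x. \<bar>g x\<bar> \<le> b) \<Longrightarrow> lipschitz_upto n g \<Longrightarrow>
        ((\<lambda>i. integral\<^sup>L (P i) g) \<longlongrightarrow> integral\<^sup>L Q g) F"
  shows "weak_conv_to P Q F"
proof -
  interpret Q: prob_space Q by fact
  have measg: "lower_env n f \<in> borel_measurable borel" if "\<And>x. \<bar>f x\<bar> \<le> b"
    for n b and f :: "halfline_path \<Rightarrow> real"
    using lower_env_lipschitz[OF that] by (rule borel_measurable_lipschitz_upto)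
  have lower: "\<forall>\<^sub>F i in F. integral\<^sup>L Q f - e < integral\<^sup>L (P i) f"
    if f: "continuous_on UNIV f" and b: "\<And>x. \<bar>f x\<bar> \<le> b" and e: "0 < e"
    for b e and f :: "halfline_path \<Rightarrow> real"
  proof -
    have fm: "f \<in> borel_measurable borel"
      using f by (rule borel_measurable_continuous_onI)
    have "(\<lambda>n. integral\<^sup>L Q (lower_env n f)) \<longlonglongrightarrow> integral\<^sup>L Q f"
    proof (rule integral_dominated_convergence[where w = "\<lambda>_. b"])
      show "f \<in> borel_measurable Q" "\<And>n. lower_env n f \<in> borel_measurable Q"
        using fm measg[OF b] Q(2) by (simp_all add: measurable_def sets_eq_imp_space_eq[OF Q(2)])
      have "open {x. a < f x}" for a
        using f by (intro open_Collect_less) simp_all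
      then show "AE x in Q. (\<lambda>n. lower_env n f x) \<longlonglongrightarrow> f x"
        by (intro AE_I2 lower_env_tendsto[where f = f and b = b] b)
      show "AE x in Q. norm (lower_env n f x) \<le> b" for n
        using lower_env_bound[where f = f, OF b] by simp
    qed simp
    then have "\<forall>\<^sub>F n in sequentially. integral\<^sup>L Q f - e / 2 < integral\<^sup>L Q (lower_env n f)"
      by (rule order_tendstoD(1)) (use e in simp)
    then obtain n where n: "integral\<^sup>L Q f - e / 2 < integral\<^sup>L Q (lower_env n f)"
      by (auto simp: eventually_sequentially)
    have "\<forall>\<^sub>F i in F. integral\<^sup>L Q (lower_env n f) - e / 2 < integral\<^sup>L (P i) (lower_env n f)"
      by (rule order_tendstoD(1)[OF conv[OF lower_env_bound lower_env_lipschitz, OF b b]])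
        (use e in simp)
    then show ?thesis
      using P
    proof eventually_elim
      case (elim i)
      interpret Pi: prob_space "P i" using elim by blast
      have "f \<in> borel_measurable (P i)" "lower_env n f \<in> borel_measurable (P i)"
        using elim fm measg[OF b] by (simp_all cong: measurable_cong_sets)
      then have "integral\<^sup>L (P i) (lower_env n f) \<le> integral\<^sup>L (P i) f"
        using b lower_env_bound[OF b] lower_env_le[OF b]
        by (intro integral_mono Pi.integrable_const_bound[where B = b]) simp_all
      then show ?case using n elim by linarith
    qed
  qed
  show ?thesis
    unfolding weak_conv_to_def
  proof (intro allI impI, elim conjE)
    fix f :: "halfline_path \<Rightarrow> real"
    assume f: "continuous_on UNIV f" and "bounded (range f)"
    then obtain b where b: "\<And>x. \<bar>f x\<bar> \<le> b" by (auto simp: bounded_iff)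
    show "((\<lambda>i. integral\<^sup>L (P i) f) \<longlongrightarrow> integral\<^sup>L Q f) F"
    proof (rule tendstoI)
      fix e :: real assume e: "0 < e"
      have "\<forall>\<^sub>F i in F. integral\<^sup>L Q f - e < integral\<^sup>L (P i) f"
        by (rule lower[OF f b e])
      moreover have "\<forall>\<^sub>F i in F. integral\<^sup>L Q (\<lambda>x. - f x) - e < integral\<^sup>L (P i) (\<lambda>x. - f x)"
      proof (rule lower[OF _ _ e])
        show "continuous_on UNIV (\<lambda>x. - f x)" using f by (rule continuous_on_minus)
        show "\<bar>- f x\<bar> \<le> b" for x using b by simp
      qed
      ultimately show "\<forall>\<^sub>F i in F. dist (integral\<^sup>L (P i) f) (integral\<^sup>L Q f) < e"
        by eventually_elim (simp add: dist_real_def abs_less_iff)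
    qed
  qed
qed

subsection \<open>Convergence of Gaussian vectors\<close>

text \<open>Merges the two cases of \<open>centered_gaussian\<close>: the degenerate law is \<sigma>
  = 0. Moments and characteristic functions then come from the standard normal law by
  scaling.\<close>

lemma centered_gaussian_distr:
  assumes "prob_space M" "centered_gaussian M Y"
  obtains \<sigma> where "0 \<le> \<sigma>" "distr M borel Y = distr std_normal_distribution borel (\<lambda>x. \<sigma> * x)"
proof -
  interpret prob_space M by fact
  have Y[measurable]: "Y \<in> borel_measurable M"
    using assms(2) by (simp add: centered_gaussian_def)
  consider \<sigma> where "0 < \<sigma>" "distributed M lborel Y (normal_density 0 \<sigma>)" | "AE \<omega> in M. Y \<omega> = 0"
    using assms(2) unfolding centered_gaussian_def by blast
  then show ?thesis
  proof cases
    case 1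
    then have "distributed M lborel (\<lambda>\<omega>. (Y \<omega> - 0) / \<sigma>) std_normal_density"
      by (subst (asm) normal_standard_normal_convert) simp_all
    then have "distr M lborel (\<lambda>\<omega>. Y \<omega> / \<sigma>) = std_normal_distribution"
      by (simp add: distributed_def)
    then have d: "distr M borel (\<lambda>\<omega>. Y \<omega> / \<sigma>) = std_normal_distribution"
      by (simp cong: distr_cong)
    have "distr std_normal_distribution borel (\<lambda>x. \<sigma> * x) = distr M borel Y"
      unfolding d[symmetric] using 1(1) by (subst distr_distr) (simp_all add: comp_def)
    with 1(1) show ?thesis by (intro that[of \<sigma>]) simp_all
  next
    case 2
    interpret N: real_distribution std_normal_distribution by (rule real_dist_normal_dist)
    have "distr M borel Y = distr M borel (\<lambda>_. 0)"
      by (rule distr_cong_AE) (use 2 in simp_all)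
    also have "\<dots> = distr std_normal_distribution borel (\<lambda>x. 0 * x)"
      by (simp add: distr_const N.distr_const)
    finally show ?thesis by (intro that[of 0]) simp_all
  qed
qed

lemma std_normal_integral_cos:
  "(LINT x|std_normal_distribution. cos (\<sigma> * x + b)) = cos b * exp (- \<sigma>\<^sup>2 / 2)"
proof -
  interpret N: real_distribution std_normal_distribution by (rule real_dist_normal_dist)
  \<comment> \<open>Reduces the integral to the characteristic function of the standard normal
    law.\<close>
  have "cos (\<sigma> * x + b) = Re (iexp b * iexp (\<sigma> * x))" for x :: real
    by (simp add: cis_mult add.commute flip: cis_conv_exp of_real_mult)
  then have "(LINT x|std_normal_distribution. cos (\<sigma> * x + b)) =
      (LINT x|std_normal_distribution. Re (iexp b * iexp (\<sigma> * x)))" by presburger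
  also have "\<dots> = Re (CLINT x|std_normal_distribution. iexp b * iexp (\<sigma> * x))"
    by (intro integral_Re integrable_mult_right N.integrable_iexp)
      (simp, rule Im_complex_of_real)
  also have "\<dots> = Re (iexp b * char std_normal_distribution \<sigma>)"
    by (simp add: char_def)
  also have "\<dots> = cos b * exp (- \<sigma>\<^sup>2 / 2)"
    by (simp add: char_std_normal_distribution flip: cis_conv_exp)
  finally show ?thesis .
qed

lemma centered_gaussian_moments:
  assumes "prob_space M" "centered_gaussian M Y"
  shows "integrable M (\<lambda>\<omega>. (Y \<omega>)\<^sup>2)"
    and "integrable M (\<lambda>\<omega>. Y \<omega> ^ 4)"
    and "(LINT \<omega>|M. Y \<omega> ^ 4) = 3 * (LINT \<omega>|M. (Y \<omega>)\<^sup>2)\<^sup>2"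
    and "(LINT \<omega>|M. cos (Y \<omega> + b)) = cos b * exp (- (LINT \<omega>|M. (Y \<omega>)\<^sup>2) / 2)"
proof -
  obtain \<sigma> where d: "distr M borel Y = distr std_normal_distribution borel (\<lambda>x. \<sigma> * x)"
    using centered_gaussian_distr[OF assms] by blast
  have Y[measurable]: "Y \<in> borel_measurable M"
    using assms(2) by (simp add: centered_gaussian_def)
  have i: "integrable M (\<lambda>\<omega>. f (Y \<omega>)) \<longleftrightarrow> integrable std_normal_distribution (\<lambda>x. f (\<sigma> * x))"
    if [measurable]: "f \<in> borel_measurable borel" for f :: "real \<Rightarrow> real"
    using integrable_distr_eq[of Y M borel f]
      integrable_distr_eq[of "\<lambda>x. \<sigma> * x" std_normal_distribution borel f] d by simp
  have e: "(LINT \<omega>|M. f (Y \<omega>)) = (LINT x|std_normal_distribution. f (\<sigma> * x))"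
    if [measurable]: "f \<in> borel_measurable borel" for f :: "real \<Rightarrow> real"
    using integral_distr[of Y M borel f]
      integral_distr[of "\<lambda>x. \<sigma> * x" std_normal_distribution borel f] d by simp
  have pow: "integrable std_normal_distribution (\<lambda>x. (\<sigma> * x) ^ k)" for k
    unfolding power_mult_distrib
    by (intro integrable_mult_right integrable_std_normal_distribution_moment)
  show "integrable M (\<lambda>\<omega>. (Y \<omega>)\<^sup>2)" "integrable M (\<lambda>\<omega>. Y \<omega> ^ 4)"
    using pow by (simp_all add: i[of "\<lambda>y. y\<^sup>2"] i[of "\<lambda>y. y ^ 4"])
  have 2: "(LINT \<omega>|M. (Y \<omega>)\<^sup>2) = \<sigma>\<^sup>2"
    using std_normal_distribution_even_moments(1)[of 1]
    by (simp add: e[of "\<lambda>y. y\<^sup>2"] power_mult_distrib)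
  have "fact 4 = (24 :: real)" by (simp add: fact_numeral)
  then have 4: "(LINT \<omega>|M. Y \<omega> ^ 4) = 3 * \<sigma> ^ 4"
    using std_normal_distribution_even_moments(1)[of 2]
    by (simp add: e[of "\<lambda>y. y ^ 4"] power_mult_distrib)
  show "(LINT \<omega>|M. Y \<omega> ^ 4) = 3 * (LINT \<omega>|M. (Y \<omega>)\<^sup>2)\<^sup>2"
    unfolding 2 4 by simp
  show "(LINT \<omega>|M. cos (Y \<omega> + b)) = cos b * exp (- (LINT \<omega>|M. (Y \<omega>)\<^sup>2) / 2)"
    unfolding 2 by (simp add: e[of "\<lambda>y. cos (y + b)"] std_normal_integral_cos)
qed

section \<open>Trigonometric polynomials in finitely many coordinates\<close>

inductive_set trig_span :: "nat \<Rightarrow> ((nat \<Rightarrow> real) \<Rightarrow> real) set" for m where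
  cos: "(\<lambda>z. a * cos ((\<Sum>k<m. c k * z k) + b)) \<in> trig_span m"
| add: "f \<in> trig_span m \<Longrightarrow> g \<in> trig_span m \<Longrightarrow> (\<lambda>z. f z + g z) \<in> trig_span m"

text \<open>The product-to-sum formula for cosines. The phase b in the generators makes cosines
  alone sufficient: sines and constants are special cases.\<close>

lemma trig_span_mult:
  assumes "f \<in> trig_span m" "g \<in> trig_span m"
  shows "(\<lambda>z. f z * g z) \<in> trig_span m"
  using assms(1)
proof induction
  case (cos a c b)
  show ?case
    using assms(2)
  proof induction
    case (cos a' c' b')
    have eq: "a * cos ((\<Sum>k<m. c k * z k) + b) * (a' * cos ((\<Sum>k<m. c' k * z k) + b')) =
        a * a' / 2 * cos ((\<Sum>k<m. (c k - c' k) * z k) + (b - b')) +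
        a * a' / 2 * cos ((\<Sum>k<m. (c k + c' k) * z k) + (b + b'))" for z
    proof -
      define u v where "u = (\<Sum>k<m. c k * z k)" and "v = (\<Sum>k<m. c' k * z k)"
      have "(\<Sum>k<m. (c k - c' k) * z k) + (b - b') = u + b - (v + b')"
        "(\<Sum>k<m. (c k + c' k) * z k) + (b + b') = u + b + (v + b')"
        by (simp_all add: u_def v_def left_diff_distrib distrib_right sum_subtractf sum.distrib)
      then show ?thesis
        unfolding u_def[symmetric] v_def[symmetric]
        by (simp only: cos_diff cos_add) (simp add: field_simps)
    qed
    show ?case
      unfolding eq by (intro trig_span.add trig_span.cos)
  next
    case (add f g)
    then show ?case by (simp add: distrib_left trig_span.add)
  qed
next
  case (add f g)
  then show ?case by (simp add: distrib_right trig_span.add)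
qed

lemma trig_span_const: "(\<lambda>_. r) \<in> trig_span m"
  using trig_span.cos[of r "\<lambda>_. 0" m 0] by simp

lemma trig_span_sin:
  assumes "k < m" shows "(\<lambda>z. sin (a * z k)) \<in> trig_span m"
proof -
  have "(\<Sum>i<m. (if i = k then a else 0) * z i) = a * z k" for z :: "nat \<Rightarrow> real"
  proof -
    have "(\<Sum>i<m. (if i = k then a else 0) * z i) = (\<Sum>i<m. if i = k then a * z i else 0)"
      by (rule sum.cong) auto
    then show ?thesis using assms by simp
  qed
  then have "(\<lambda>z. 1 * cos ((\<Sum>i<m. (if i = k then a else 0) * z i) + - (pi / 2))) =
      (\<lambda>z. sin (a * z k))"
    by (simp add: cos_diff flip: diff_conv_add_uminus)
  then show ?thesis
    using trig_span.cos[of 1 "\<lambda>i. if i = k then a else 0" m "- (pi / 2)"] by (simp only:)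
qed

text \<open>Coordinates from m on are pinned to 0, so that the first m coordinates separate points,
  and the set is compact by Tychonoff, inside the type
  \<open>nat \<Rightarrow> real\<close>.\<close>

definition cube :: "nat \<Rightarrow> (nat \<Rightarrow> real) set" where
  "cube m = (\<Pi>\<^sub>E k\<in>UNIV. if k < m then {-1..1} else {0})"

lemma compact_cube: "compact (cube m)"
proof -
  have "compactin (product_topology (\<lambda>_. euclidean) UNIV) (cube m)"
    unfolding cube_def by (subst compactin_PiE) auto
  then show ?thesis by (simp add: euclidean_product_topology)
qed

text \<open>Stone-Weierstrass on the cube, for the algebra of those continuous functions that become
  trigonometric polynomials when sines are substituted. It separates points because coordinates
  become sines. As sines always land in the cube, the bound holds for every z, however
  large.\<close>

lemma trig_span_approx:
  assumes H: "continuous_on (cube m) H" and e: "0 < e"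
  obtains P where "P \<in> trig_span m"
    "\<And>z. \<bar>H (\<lambda>k. if k < m then sin (a * z k) else 0) - P z\<bar> < e"
proof -
  define s where "s z = (\<lambda>k. if k < m then sin (a * z k) else 0)" for z :: "nat \<Rightarrow> real"
  have s: "s z \<in> cube m" for z
    by (auto simp: s_def cube_def)
  define R where "R = {F. continuous_on (cube m) F \<and> (\<lambda>z. F (s z)) \<in> trig_span m}"
  interpret function_ring_on R "cube m"
  proof
    show "compact (cube m)" by (rule compact_cube)
    show "(\<lambda>_. c) \<in> R" for c by (simp add: R_def trig_span_const)
    fix x y assume xy: "x \<in> cube m" "y \<in> cube m" "x \<noteq> y"
    then obtain k where k: "x k \<noteq> y k" by blast
    have zero: "x k = 0 \<and> y k = 0" if "\<not> k < m"
      using PiE_mem[OF xy(1)[unfolded cube_def], of k] PiE_mem[OF xy(2)[unfolded cube_def], of k] that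
      by simp
    have "k < m"
    proof (rule ccontr)
      assume "\<not> k < m"
      with zero k show False by simp
    qed
    then have "(\<lambda>z. s z k) \<in> trig_span m"
      unfolding s_def by (simp add: trig_span_sin)
    moreover have "continuous_on (cube m) (\<lambda>z. z k)"
      by (rule continuous_on_subset[OF continuous_on_product_coordinates]) simp
    ultimately have "(\<lambda>z. z k) \<in> R"
      by (simp add: R_def)
    with k show "\<exists>f\<in>R. f x \<noteq> f y"
      by (intro bexI[of _ "\<lambda>z. z k"])
  qed (simp_all add: R_def trig_span_mult trig_span.add continuous_on_add continuous_on_mult)
  obtain F where F: "F \<in> UNIV \<rightarrow> R" and lim: "uniform_limit (cube m) F H sequentially"
    using Stone_Weierstrass[OF H] ..
  from uniform_limitD[OF lim e] obtain n where "\<forall>x\<in>cube m. dist (F n x) (H x) < e"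
    by (auto simp: eventually_sequentially)
  then have "dist (F n (s z)) (H (s z)) < e" for z
    using bspec[OF _ s] by blast
  then have "\<bar>H (s z) - F n (s z)\<bar> < e" for z
    by (simp add: dist_real_def abs_minus_commute)
  moreover have "(\<lambda>z. F n (s z)) \<in> trig_span m"
    using funcset_mem[OF F, of n] by (simp add: R_def)
  ultimately show ?thesis
    unfolding s_def by (intro that)
qed

definition gaussian_vector :: "nat \<Rightarrow> 'a measure \<Rightarrow> ('a \<Rightarrow> nat \<Rightarrow> real) \<Rightarrow> bool" where
  "gaussian_vector m M W \<longleftrightarrow> prob_space M \<and> W \<in> borel_measurable M \<and>
     (\<forall>c. centered_gaussian M (\<lambda>\<omega>. \<Sum>k<m. c k * W \<omega> k))"

lemma gaussian_vector_coord:
  assumes "gaussian_vector m M W" "k < m"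
  shows "centered_gaussian M (\<lambda>\<omega>. W \<omega> k)"
proof -
  have "(\<Sum>i<m. (if i = k then 1 else 0) * W \<omega> i) = W \<omega> k" for \<omega>
  proof -
    have "(\<Sum>i<m. (if i = k then 1 else 0) * W \<omega> i) = (\<Sum>i<m. if i = k then W \<omega> i else 0)"
      by (rule sum.cong) auto
    then show ?thesis using assms(2) by simp
  qed
  then show ?thesis
    using assms(1)[unfolded gaussian_vector_def, THEN conjunct2, THEN conjunct2,
        THEN spec[of _ "\<lambda>i. if i = k then 1 else 0"]] by (simp only:)
qed

lemma integrable_mult_squares:
  fixes X Y :: "'a \<Rightarrow> real"
  assumes [measurable]: "X \<in> borel_measurable M" "Y \<in> borel_measurable M"
    and "integrable M (\<lambda>\<omega>. (X \<omega>)\<^sup>2)" "integrable M (\<lambda>\<omega>. (Y \<omega>)\<^sup>2)"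
  shows "integrable M (\<lambda>\<omega>. X \<omega> * Y \<omega>)"
proof (rule Bochner_Integration.integrable_bound)
  show "integrable M (\<lambda>\<omega>. (X \<omega>)\<^sup>2 + (Y \<omega>)\<^sup>2)" using assms by simp
  have "\<bar>x * y\<bar> \<le> x\<^sup>2 + y\<^sup>2" for x y :: real
    using sum_squares_bound[of "\<bar>x\<bar>" "\<bar>y\<bar>"] zero_le_power2[of x] zero_le_power2[of y]
    unfolding abs_mult power2_abs mult.assoc by linarith
  then show "AE \<omega> in M. norm (X \<omega> * Y \<omega>) \<le> norm ((X \<omega>)\<^sup>2 + (Y \<omega>)\<^sup>2)"
    by simp
qed simp

lemma gaussian_vector_integrable_mult:
  assumes "gaussian_vector m M W" "k < m" "l < m"
  shows "integrable M (\<lambda>\<omega>. W \<omega> k * W \<omega> l)"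
proof -
  have p: "prob_space M" using assms(1) by (simp add: gaussian_vector_def)
  note c = gaussian_vector_coord[OF assms(1)]
  show ?thesis
    using c[OF assms(2)] c[OF assms(3)]
    by (intro integrable_mult_squares centered_gaussian_moments(1)[OF p] c assms)
       (simp_all add: centered_gaussian_def)
qed

lemma gaussian_vector_variance:
  assumes "gaussian_vector m M W"
  shows "(LINT \<omega>|M. (\<Sum>k<m. c k * W \<omega> k)\<^sup>2) =
    (\<Sum>k<m. \<Sum>l<m. c k * c l * (LINT \<omega>|M. W \<omega> k * W \<omega> l))"
proof -
  have "(LINT \<omega>|M. (\<Sum>k<m. c k * W \<omega> k)\<^sup>2) =
      (LINT \<omega>|M. (\<Sum>k<m. \<Sum>l<m. c k * c l * (W \<omega> k * W \<omega> l)))"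
    by (simp add: power2_eq_square sum_product mult_ac)
  also have "\<dots> = (\<Sum>k<m. LINT \<omega>|M. (\<Sum>l<m. c k * c l * (W \<omega> k * W \<omega> l)))"
    by (intro Bochner_Integration.integral_sum Bochner_Integration.integrable_sum
        integrable_mult_right gaussian_vector_integrable_mult[OF assms]) simp_all
  also have "\<dots> = (\<Sum>k<m. \<Sum>l<m. LINT \<omega>|M. c k * c l * (W \<omega> k * W \<omega> l))"
  proof (rule sum.cong[OF refl])
    fix k assume "k \<in> {..<m}"
    then show "(LINT \<omega>|M. (\<Sum>l<m. c k * c l * (W \<omega> k * W \<omega> l))) =
        (\<Sum>l<m. LINT \<omega>|M. c k * c l * (W \<omega> k * W \<omega> l))"
      by (intro Bochner_Integration.integral_sum integrable_mult_right
        gaussian_vector_integrable_mult[OF assms]) simp_all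
  qed
  also have "\<dots> = (\<Sum>k<m. \<Sum>l<m. c k * c l * (LINT \<omega>|M. W \<omega> k * W \<omega> l))"
    by simp
  finally show ?thesis .
qed

text \<open>The expectation of a cosine of a Gaussian linear combination is a continuous function of
  the covariances. Measurability and boundedness of P are part of the induction because they justify
  splitting the integral of a sum.\<close>

lemma trig_span_integral_tendsto:
  fixes W :: "'i \<Rightarrow> 'a \<Rightarrow> nat \<Rightarrow> real" and V :: "'b \<Rightarrow> nat \<Rightarrow> real"
  assumes W: "\<forall>\<^sub>F i in F. gaussian_vector m (M i) (W i)" and V: "gaussian_vector m N V"
    and cov: "\<And>k l. k < m \<Longrightarrow> l < m \<Longrightarrow>
      ((\<lambda>i. LINT \<omega>|M i. W i \<omega> k * W i \<omega> l) \<longlongrightarrow> (LINT \<omega>|N. V \<omega> k * V \<omega> l)) F"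
    and P: "P \<in> trig_span m"
  shows "((\<lambda>i. LINT \<omega>|M i. P (W i \<omega>)) \<longlongrightarrow> (LINT \<omega>|N. P (V \<omega>))) F \<and> P \<in> borel_measurable borel \<and>
    bounded (range P)"
  using P
proof induction
  case (cos a c b)
  have val: "(LINT \<omega>|M'. a * cos ((\<Sum>k<m. c k * U \<omega> k) + b)) = a * (cos b *
      exp (- (\<Sum>k<m. \<Sum>l<m. c k * c l * (LINT \<omega>|M'. U \<omega> k * U \<omega> l)) / 2))"
    if "gaussian_vector m M' U" for M' :: "'c measure" and U
    using that centered_gaussian_moments(4)[of M' "\<lambda>\<omega>. \<Sum>k<m. c k * U \<omega> k" b]
    by (simp add: gaussian_vector_variance[OF that] gaussian_vector_def)
  have "((\<lambda>i. a * (cos b *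
      exp (- (\<Sum>k<m. \<Sum>l<m. c k * c l * (LINT \<omega>|M i. W i \<omega> k * W i \<omega> l)) / 2))) \<longlongrightarrow>
      (LINT \<omega>|N. a * cos ((\<Sum>k<m. c k * V \<omega> k) + b))) F"
    unfolding val[OF V] by (intro tendsto_intros cov) auto
  moreover have "\<forall>\<^sub>F i in F. a * (cos b *
      exp (- (\<Sum>k<m. \<Sum>l<m. c k * c l * (LINT \<omega>|M i. W i \<omega> k * W i \<omega> l)) / 2)) =
      (LINT \<omega>|M i. a * cos ((\<Sum>k<m. c k * W i \<omega> k) + b))"
    using W by eventually_elim (rule val[symmetric])
  ultimately have "((\<lambda>i. LINT \<omega>|M i. a * cos ((\<Sum>k<m. c k * W i \<omega> k) + b)) \<longlongrightarrow>
      (LINT \<omega>|N. a * cos ((\<Sum>k<m. c k * V \<omega> k) + b))) F"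
    by (rule Lim_transform_eventually)
  moreover have "(\<lambda>z. a * cos ((\<Sum>k<m. c k * z k) + b)) \<in> borel_measurable borel"
    by (intro borel_measurable_continuous_onI continuous_intros continuous_on_product_coordinates)
  moreover have "bounded (range (\<lambda>z :: nat \<Rightarrow> real. a * cos ((\<Sum>k<m. c k * z k) + b)))"
    by (rule boundedI[of _ "\<bar>a\<bar>"]) (auto simp: abs_mult mult_left_le)
  ultimately show ?case by blast
next
  case (add f g)
  then obtain bf bg where b: "\<And>z. \<bar>f z\<bar> \<le> bf" "\<And>z. \<bar>g z\<bar> \<le> bg"
    by (auto simp: bounded_iff)
  have m[measurable]: "f \<in> borel_measurable borel" "g \<in> borel_measurable borel"
    using add by blast+
  have val: "(LINT \<omega>|M'. f (U \<omega>) + g (U \<omega>)) = (LINT \<omega>|M'. f (U \<omega>)) + (LINT \<omega>|M'. g (U \<omega>))"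
    if "gaussian_vector m M' U" for M' :: "'c measure" and U
  proof -
    interpret prob_space M' using that by (simp add: gaussian_vector_def)
    have [measurable]: "U \<in> borel_measurable M'" using that by (simp add: gaussian_vector_def)
    show ?thesis
      by (intro Bochner_Integration.integral_add integrable_const_bound[where B = bf]
          integrable_const_bound[where B = bg]) (simp_all add: b)
  qed
  have "((\<lambda>i. (LINT \<omega>|M i. f (W i \<omega>)) + (LINT \<omega>|M i. g (W i \<omega>))) \<longlongrightarrow>
      (LINT \<omega>|N. f (V \<omega>) + g (V \<omega>))) F"
    unfolding val[OF V] using add by (intro tendsto_add) blast+
  moreover have "\<forall>\<^sub>F i in F. (LINT \<omega>|M i. f (W i \<omega>)) + (LINT \<omega>|M i. g (W i \<omega>)) =
      (LINT \<omega>|M i. f (W i \<omega>) + g (W i \<omega>))"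
    using W by eventually_elim (rule val[symmetric])
  ultimately have "((\<lambda>i. LINT \<omega>|M i. f (W i \<omega>) + g (W i \<omega>)) \<longlongrightarrow>
      (LINT \<omega>|N. f (V \<omega>) + g (V \<omega>))) F"
    by (rule Lim_transform_eventually)
  moreover have "bounded (range (\<lambda>z. f z + g z))"
    using add by (intro bounded_plus_comp) blast+
  ultimately show ?case by simp
qed

lemma integral_abs_le:
  fixes f g :: "'a \<Rightarrow> real"
  assumes "integrable M f" "integrable M g" "\<And>x. x \<in> space M \<Longrightarrow> \<bar>f x\<bar> \<le> g x"
  shows "\<bar>\<integral>x. f x \<partial>M\<bar> \<le> (\<integral>x. g x \<partial>M)"
proof -
  have "(\<integral>x. \<bar>f x\<bar> \<partial>M) \<le> (\<integral>x. g x \<partial>M)"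
    using assms by (intro integral_mono integrable_abs)
  then show ?thesis using integral_abs_bound[of M f] by linarith
qed

lemma trig_span_approx_quadratic:
  assumes h: "continuous_on UNIV h" and b: "\<And>z. \<bar>h z\<bar> \<le> b"
    and dep: "\<forall>z z'. (\<forall>k<m. z k = z' k) \<longrightarrow> h z = h z'"
    and r: "0 < r" and e: "0 < e"
  obtains P where "P \<in> trig_span m"
    "\<And>z. \<bar>h z - P z\<bar> \<le> 2 * b / r\<^sup>2 * (\<Sum>k<m. (z k)\<^sup>2) + e"
proof -
  (* arcsin (sin (a x)) / a = x for |x| <= r, so h is replaced by a function of the sines that
     is still bounded by b, and Chebyshev controls the error outside the box. *)
  define a where "a = pi / (2 * r)"
  have a: "0 < a" using r by (simp add: a_def)
  define H where "H y = h (\<lambda>k. arcsin (y k) / a)" for y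
  have mem: "y k \<in> {-1..1}" if "y \<in> cube m" for y k
    using PiE_mem[OF that[unfolded cube_def], of k] by (auto split: if_splits)
  have "continuous_on (cube m) H"
    unfolding H_def
    using a mem
    by (intro continuous_on_compose2[OF h] continuous_on_coordinatewise_then_product
        continuous_intros continuous_on_subset[OF continuous_on_product_coordinates]) auto
  then obtain P where P: "P \<in> trig_span m"
    "\<And>z. \<bar>H (\<lambda>k. if k < m then sin (a * z k) else 0) - P z\<bar> < e"
    using trig_span_approx[OF _ e] by blast
  define T where "T z = H (\<lambda>k. if k < m then sin (a * z k) else 0)" for z
  define Q where "Q z = (\<Sum>k<m. (z k)\<^sup>2)" for z :: "nat \<Rightarrow> real"
  have Q: "0 \<le> Q z" "k < m \<Longrightarrow> (z k)\<^sup>2 \<le> Q z" for z k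
    unfolding Q_def by (simp_all add: sum_nonneg member_le_sum[of k "{..<m}" "\<lambda>k. (z k)\<^sup>2"])
  have b0: "0 \<le> b" by (rule order_trans[OF abs_ge_zero b])
  have hT: "\<bar>h z - T z\<bar> \<le> 2 * b / r\<^sup>2 * Q z" for z
  proof (cases "\<forall>k<m. \<bar>z k\<bar> \<le> r")
    case True
    have "arcsin (sin (a * z k)) / a = z k" if "k < m" for k
    proof -
      have "\<bar>a * z k\<bar> \<le> a * r"
        using True that a by (simp add: abs_mult)
      moreover have "a * r = pi / 2" using r by (simp add: a_def)
      ultimately show ?thesis using a by (subst arcsin_sin) auto
    qed
    \<comment> \<open>\<open>T\<close> replaces the coordinates from m on by 0, which
      \<open>dep\<close> allows.\<close>
    then have "T z = h z"
      unfolding T_def H_def by (intro dep[rule_format]) simp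
    then show ?thesis using b0 Q(1)[of z] by simp
  next
    case False
    then obtain k where k: "k < m" "r < \<bar>z k\<bar>" by (meson not_le)
    have "r\<^sup>2 \<le> \<bar>z k\<bar>\<^sup>2" using k(2) r by (intro power_mono) simp_all
    also have "\<dots> \<le> Q z" using Q(2)[OF k(1)] by simp
    finally have "1 \<le> Q z / r\<^sup>2" using r by simp
    then have "2 * b * 1 \<le> 2 * b * (Q z / r\<^sup>2)" using b0 by (intro mult_left_mono) simp_all
    moreover have "\<bar>T z\<bar> \<le> b" unfolding T_def H_def by (rule b)
    ultimately show ?thesis using b[of z] by (simp add: abs_le_iff)
  qed
  have "\<bar>h z - P z\<bar> \<le> 2 * b / r\<^sup>2 * Q z + e" for z
    using hT[of z] P(2)[of z, folded T_def] by linarith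
  with P(1) show ?thesis unfolding Q_def by (rule that)
qed

text \<open>On an unbounded space the trigonometric approximation cannot be uniform; its error grows
  quadratically instead. Integrated, the quadratic term is a multiple of the sum of the variances,
  which is eventually below S + 1. This control of second moments stands in for tightness.\<close>

lemma gaussian_vector_integral_tendsto:
  fixes W :: "'i \<Rightarrow> 'a \<Rightarrow> nat \<Rightarrow> real" and V :: "'b \<Rightarrow> nat \<Rightarrow> real"
    and h :: "(nat \<Rightarrow> real) \<Rightarrow> real"
  assumes W: "\<forall>\<^sub>F i in F. gaussian_vector m (M i) (W i)" and V: "gaussian_vector m N V"
    and cov: "\<And>k l. k < m \<Longrightarrow> l < m \<Longrightarrow>
      ((\<lambda>i. LINT \<omega>|M i. W i \<omega> k * W i \<omega> l) \<longlongrightarrow> (LINT \<omega>|N. V \<omega> k * V \<omega> l)) F"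
    and h: "continuous_on UNIV h" and b: "\<And>z. \<bar>h z\<bar> \<le> b"
    and dep: "\<forall>z z'. (\<forall>k<m. z k = z' k) \<longrightarrow> h z = h z'"
  shows "((\<lambda>i. LINT \<omega>|M i. h (W i \<omega>)) \<longlongrightarrow> (LINT \<omega>|N. h (V \<omega>))) F"
proof (rule tendstoI)
  fix e :: real assume e: "0 < e"
  have b0: "0 \<le> b" by (rule order_trans[OF abs_ge_zero b])
  define S where "S = (\<Sum>k<m. LINT \<omega>|N. V \<omega> k * V \<omega> k)"
  have S0: "0 \<le> S" unfolding S_def by (intro sum_nonneg integral_nonneg_AE) simp
  \<comment> \<open>Chosen so that the quadratic error has expectation at most e/8; the added ones
    keep r positive when b or S vanishes.\<close>
  define r where "r = sqrt (16 * (b + 1) * (S + 1) / e)"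
  have r: "0 < r" using b0 S0 e by (simp add: r_def)
  have r2: "2 * b / r\<^sup>2 * (S + 1) \<le> e / 8"
    using b0 S0 e by (simp add: r_def divide_simps)
  have e8: "0 < e / 8" using e by simp
  obtain P where P: "P \<in> trig_span m"
    "\<And>z. \<bar>h z - P z\<bar> \<le> 2 * b / r\<^sup>2 * (\<Sum>k<m. (z k)\<^sup>2) + e / 8"
    using trig_span_approx_quadratic[OF h b dep r e8] by blast
  have Pm: "P \<in> borel_measurable borel" "bounded (range P)"
    and PW: "((\<lambda>i. LINT \<omega>|M i. P (W i \<omega>)) \<longlongrightarrow> (LINT \<omega>|N. P (V \<omega>))) F"
  proof -
    have "((\<lambda>i. LINT \<omega>|M i. P (W i \<omega>)) \<longlongrightarrow> (LINT \<omega>|N. P (V \<omega>))) F \<and> P \<in> borel_measurable borel \<and>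
        bounded (range P)"
      by (rule trig_span_integral_tendsto[OF W V _ P(1)]) (rule cov)
    then show "P \<in> borel_measurable borel" "bounded (range P)"
      "((\<lambda>i. LINT \<omega>|M i. P (W i \<omega>)) \<longlongrightarrow> (LINT \<omega>|N. P (V \<omega>))) F"
      by simp_all
  qed
  obtain bP where bP: "\<And>z. \<bar>P z\<bar> \<le> bP" using Pm(2) by (auto simp: bounded_iff)
  have hm: "h \<in> borel_measurable borel" using h by (rule borel_measurable_continuous_onI)
  have close: "\<bar>(LINT \<omega>|M'. h (U \<omega>)) - (LINT \<omega>|M'. P (U \<omega>))\<bar> \<le> e / 4"
    if U: "gaussian_vector m M' U" and s: "(\<Sum>k<m. LINT \<omega>|M'. U \<omega> k * U \<omega> k) \<le> S + 1"
    for M' :: "'c measure" and U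
  proof -
    interpret prob_space M' using U by (simp add: gaussian_vector_def)
    have [measurable]: "U \<in> borel_measurable M'" using U by (simp add: gaussian_vector_def)
    note [measurable] = hm Pm(1)
    have i1: "integrable M' (\<lambda>\<omega>. h (U \<omega>))"
      by (rule integrable_const_bound[where B = b]) (simp_all add: b)
    have i2: "integrable M' (\<lambda>\<omega>. P (U \<omega>))"
      by (rule integrable_const_bound[where B = bP]) (simp_all add: bP)
    have sq: "integrable M' (\<lambda>\<omega>. (U \<omega> k)\<^sup>2)" if "k < m" for k
      using gaussian_vector_integrable_mult[OF U that that] by (simp add: power2_eq_square)
    have iS: "integrable M' (\<lambda>\<omega>. \<Sum>k<m. (U \<omega> k)\<^sup>2)"
      using sq by (intro Bochner_Integration.integrable_sum) simp
    have "\<bar>(LINT \<omega>|M'. h (U \<omega>)) - (LINT \<omega>|M'. P (U \<omega>))\<bar> = \<bar>LINT \<omega>|M'. h (U \<omega>) - P (U \<omega>)\<bar>"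
      using i1 i2 by simp
    also have "\<dots> \<le> (LINT \<omega>|M'. 2 * b / r\<^sup>2 * (\<Sum>k<m. (U \<omega> k)\<^sup>2) + e / 8)"
      using i1 i2 iS P(2) by (intro integral_abs_le) simp_all
    also have "\<dots> = 2 * b / r\<^sup>2 * (\<Sum>k<m. LINT \<omega>|M'. (U \<omega> k)\<^sup>2) + e / 8"
      using iS sq by (simp add: Bochner_Integration.integral_sum prob_space)
    also have "\<dots> \<le> 2 * b / r\<^sup>2 * (S + 1) + e / 8"
      using s b0 by (intro add_right_mono mult_left_mono) (simp_all add: power2_eq_square)
    also have "\<dots> \<le> e / 4" using r2 by simp
    finally show ?thesis .
  qed
  have "((\<lambda>i. \<Sum>k<m. LINT \<omega>|M i. W i \<omega> k * W i \<omega> k) \<longlongrightarrow> S) F"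
    unfolding S_def by (intro tendsto_sum cov) simp_all
  then have "\<forall>\<^sub>F i in F. (\<Sum>k<m. LINT \<omega>|M i. W i \<omega> k * W i \<omega> k) < S + 1"
    by (rule order_tendstoD(2)) simp
  moreover have "\<forall>\<^sub>F i in F. dist (LINT \<omega>|M i. P (W i \<omega>)) (LINT \<omega>|N. P (V \<omega>)) < e / 4"
    using PW by (rule tendstoD) (use e in simp)
  moreover note W
  ultimately show "\<forall>\<^sub>F i in F. dist (LINT \<omega>|M i. h (W i \<omega>)) (LINT \<omega>|N. h (V \<omega>)) < e"
  proof eventually_elim
    case (elim i)
    have "\<bar>(LINT \<omega>|M i. h (W i \<omega>)) - (LINT \<omega>|M i. P (W i \<omega>))\<bar> \<le> e / 4"
      using elim by (intro close) simp_all
    moreover have "\<bar>(LINT \<omega>|N. h (V \<omega>)) - (LINT \<omega>|N. P (V \<omega>))\<bar> \<le> e / 4"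
      using V by (intro close) (simp_all add: S_def)
    ultimately show ?case
      using elim(2) e unfolding dist_real_def by linarith
  qed
qed

subsection \<open>Weak convergence of continuous Gaussian processes\<close>

text \<open>Needed because the paths are known to be continuous only on \<open>space M\<close>, so
  \<open>path_of\<close> reproduces the process only there.\<close>

lemma centered_gaussian_cong:
  assumes "\<And>\<omega>. \<omega> \<in> space M \<Longrightarrow> X \<omega> = Y \<omega>"
  shows "centered_gaussian M X \<longleftrightarrow> centered_gaussian M Y"
proof -
  have "X \<in> borel_measurable M \<longleftrightarrow> Y \<in> borel_measurable M"
    using assms by (rule measurable_cong)
  moreover have "X \<in> measurable M lborel \<longleftrightarrow> Y \<in> measurable M lborel"
    using assms by (rule measurable_cong)
  moreover have "distr M lborel X = distr M lborel Y"
    using assms by (intro distr_cong) simp_all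
  moreover have "(AE \<omega> in M. X \<omega> = 0) \<longleftrightarrow> (AE \<omega> in M. Y \<omega> = 0)"
    using assms by (intro AE_cong) simp
  ultimately show ?thesis
    unfolding centered_gaussian_def distributed_def by simp
qed

definition continuous_gaussian_process :: "'a measure \<Rightarrow> (real \<Rightarrow> 'a \<Rightarrow> real) \<Rightarrow> bool" where
  "continuous_gaussian_process M X \<longleftrightarrow> centered_gaussian_process M X \<and>
     (\<forall>\<omega>\<in>space M. continuous_on {0..} (\<lambda>t. X t \<omega>))"

definition path_of :: "(real \<Rightarrow> 'a \<Rightarrow> real) \<Rightarrow> 'a \<Rightarrow> halfline_path" where
  "path_of X \<omega> = Path (restrict (\<lambda>t. X t \<omega>) {0..})"

definition variogram_bound :: "real \<Rightarrow> 'a measure \<Rightarrow> (real \<Rightarrow> 'a \<Rightarrow> real) \<Rightarrow> bool" where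
  "variogram_bound K M X \<longleftrightarrow>
     (\<forall>s t. 0 \<le> s \<and> s \<le> t \<longrightarrow> (LINT \<omega>|M. (X t \<omega> - X s \<omega>)\<^sup>2) \<le> K * (t - s))"

context
  fixes M :: "'a measure" and X :: "real \<Rightarrow> 'a \<Rightarrow> real"
  assumes X: "continuous_gaussian_process M X"
begin

lemma process_prob_space: "prob_space M"
  using X by (simp add: continuous_gaussian_process_def centered_gaussian_process_def)

lemma process_measurable: "0 \<le> t \<Longrightarrow> X t \<in> borel_measurable M"
  using X by (simp add: continuous_gaussian_process_def centered_gaussian_process_def)

lemma process_gaussian:
  assumes "finite I" "I \<subseteq> {0..}"
  shows "centered_gaussian M (\<lambda>\<omega>. \<Sum>t\<in>I. c t * X t \<omega>)"
  using X assms by (simp add: continuous_gaussian_process_def centered_gaussian_process_def)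

lemma path_fun_path_of: "\<omega> \<in> space M \<Longrightarrow> 0 \<le> t \<Longrightarrow> path_fun (path_of X \<omega>) t = X t \<omega>"
  using X unfolding continuous_gaussian_process_def path_of_def
  by (simp add: path_fun_Path_restrict)

lemma samples_path_of: "\<omega> \<in> space M \<Longrightarrow> samples j (path_of X \<omega>) k = X (real k / 2 ^ j) \<omega>"
  by (simp add: samples_def path_fun_path_of)

lemma path_of_measurable [measurable]: "path_of X \<in> borel_measurable M"
proof (rule measurable_path)
  fix t :: real assume t: "0 \<le> t"
  then have "(\<lambda>\<omega>. path_fun (path_of X \<omega>) t) \<in> borel_measurable M \<longleftrightarrow> X t \<in> borel_measurable M"
    by (intro measurable_cong path_fun_path_of)
  then show "(\<lambda>\<omega>. path_fun (path_of X \<omega>) t) \<in> borel_measurable M"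
    using process_measurable[OF t] by simp
qed

lemma path_law_eq: "path_law M X = distr M borel (path_of X)"
  unfolding path_law_def path_of_def ..

lemma prob_space_path_law: "prob_space (path_law M X)"
  unfolding path_law_eq by (intro prob_space.prob_space_distr process_prob_space path_of_measurable)

lemma sets_path_law: "sets (path_law M X) = sets borel"
  unfolding path_law_eq by simp

lemma integral_path_law:
  fixes g :: "halfline_path \<Rightarrow> real"
  assumes "g \<in> borel_measurable borel"
  shows "integral\<^sup>L (path_law M X) g = (LINT \<omega>|M. g (path_of X \<omega>))"
  unfolding path_law_eq using path_of_measurable assms by (rule integral_distr)

lemma gaussian_vector_samples: "gaussian_vector m M (\<lambda>\<omega>. samples j (path_of X \<omega>))"
  unfolding gaussian_vector_def
proof (intro conjI allI process_prob_space)
  show "(\<lambda>\<omega>. samples j (path_of X \<omega>)) \<in> borel_measurable M"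
  proof (rule measurable_coordinatewise_then_product)
    fix k
    have "(\<lambda>\<omega>. samples j (path_of X \<omega>) k) \<in> borel_measurable M \<longleftrightarrow>
        X (real k / 2 ^ j) \<in> borel_measurable M"
      by (intro measurable_cong samples_path_of)
    then show "(\<lambda>\<omega>. samples j (path_of X \<omega>) k) \<in> borel_measurable M"
      using process_measurable[of "real k / 2 ^ j"] by simp
  qed
  fix c :: "nat \<Rightarrow> real"
  let ?g = "\<lambda>k. real k / 2 ^ j"
  have inj: "inj_on ?g {..<m}" by (auto simp: inj_on_def)
  \<comment> \<open>The Gaussian property speaks of sums over sets of times, so the coefficients are
    carried from indices to times along the injective grid map.\<close>
  have "centered_gaussian M (\<lambda>\<omega>. \<Sum>t\<in>?g ` {..<m}. c (the_inv_into {..<m} ?g t) * X t \<omega>)"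
    by (rule process_gaussian) auto
  moreover have "(\<Sum>t\<in>?g ` {..<m}. c (the_inv_into {..<m} ?g t) * X t \<omega>) =
      (\<Sum>k<m. c k * X (?g k) \<omega>)" for \<omega>
    unfolding sum.reindex[OF inj] by (intro sum.cong) (simp_all add: the_inv_into_f_f[OF inj])
  ultimately have "centered_gaussian M (\<lambda>\<omega>. \<Sum>k<m. c k * X (?g k) \<omega>)" by simp
  then show "centered_gaussian M (\<lambda>\<omega>. \<Sum>k<m. c k * samples j (path_of X \<omega>) k)"
    by (subst centered_gaussian_cong) (simp_all add: samples_path_of)
qed

lemma integral_samples_mult:
  "(LINT \<omega>|M. samples j (path_of X \<omega>) k * samples j (path_of X \<omega>) l) =
    (LINT \<omega>|M. X (real k / 2 ^ j) \<omega> * X (real l / 2 ^ j) \<omega>)"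
  by (intro Bochner_Integration.integral_cong) (simp_all add: samples_path_of)

lemma centered_gaussian_increment:
  assumes "0 \<le> s" "s \<le> t"
  shows "centered_gaussian M (\<lambda>\<omega>. X t \<omega> - X s \<omega>)"
\<comment> \<open>For s = t the set {s, t} collapses and the two coefficients cannot be told
  apart.\<close>
proof (cases "s = t")
  case True
  then show ?thesis by (simp add: centered_gaussian_def)
next
  case False
  have "centered_gaussian M (\<lambda>\<omega>. \<Sum>u\<in>{s, t}. (if u = t then 1 else - 1) * X u \<omega>)"
    by (rule process_gaussian) (use assms in auto)
  then show ?thesis using False by simp
qed

text \<open>For a centered Gaussian the fourth moment is three times the squared variance. This
  raises the exponent of t - s from 1 to 2.\<close>

lemma increment_fourth_moment:
  assumes K: "variogram_bound K M X" and st: "0 \<le> s" "s \<le> t"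
  shows "integrable M (\<lambda>\<omega>. (X t \<omega> - X s \<omega>) ^ 4)"
    and "(LINT \<omega>|M. (X t \<omega> - X s \<omega>) ^ 4) \<le> 3 * (K * (t - s))\<^sup>2"
proof -
  note m = centered_gaussian_moments[OF process_prob_space centered_gaussian_increment[OF st]]
  show "integrable M (\<lambda>\<omega>. (X t \<omega> - X s \<omega>) ^ 4)" by (rule m(2))
  have "(LINT \<omega>|M. (X t \<omega> - X s \<omega>)\<^sup>2)\<^sup>2 \<le> (K * (t - s))\<^sup>2"
    using K st unfolding variogram_bound_def by (intro power_mono integral_nonneg_AE) simp_all
  then show "(LINT \<omega>|M. (X t \<omega> - X s \<omega>) ^ 4) \<le> 3 * (K * (t - s))\<^sup>2"
    unfolding m(3) by simp
qed

end

section \<open>Chaining along dyadic levels\<close>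

lemma geometric_tail_bound:
  fixes a :: "nat \<Rightarrow> real"
  assumes step: "\<And>j. \<bar>a (Suc j) - a j\<bar> \<le> c * q ^ j"
    and q: "0 \<le> q" "q < 1" and lim: "a \<longlonglongrightarrow> l"
  shows "\<bar>l - a j\<bar> \<le> c * q ^ j / (1 - q)"
proof -
  have part: "\<bar>a (j + k) - a j\<bar> \<le> c * q ^ j * (1 - q ^ k) / (1 - q)" for k
  proof (induction k)
    case (Suc k)
    have "c * q ^ j * (1 - q ^ k) / (1 - q) + c * q ^ (j + k) = c * q ^ j * (1 - q ^ Suc k) / (1 - q)"
      using q(2) by (simp add: field_simps power_add)
    then show ?case using Suc step[of "j + k"] by simp
  qed simp
  have "0 \<le> c" using step[of 0] by simp
  have "\<bar>a (j + k) - a j\<bar> \<le> c * q ^ j / (1 - q)" for k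
  proof -
    have "c * q ^ j * (1 - q ^ k) \<le> c * q ^ j * 1"
      using \<open>0 \<le> c\<close> q by (intro mult_left_mono) simp_all
    then have "c * q ^ j * (1 - q ^ k) / (1 - q) \<le> c * q ^ j / (1 - q)"
      using q by (intro divide_right_mono) simp_all
    with part[of k] show ?thesis by linarith
  qed
  moreover have "(\<lambda>k. \<bar>a (j + k) - a j\<bar>) \<longlonglongrightarrow> \<bar>l - a j\<bar>"
    using LIMSEQ_ignore_initial_segment[OF lim, of j]
    by (intro tendsto_intros) (simp add: add.commute)
  ultimately show ?thesis by (intro LIMSEQ_le_const2) blast+
qed

text \<open>A pointwise form of Markov's inequality: values up to e are paid by e, larger ones by
  the fourth power. Unlike a tail estimate it can be integrated directly.\<close>

lemma abs_le_plus_power4: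
  fixes x e :: real
  assumes "0 < e"
  shows "\<bar>x\<bar> \<le> e + x ^ 4 / e ^ 3"
proof (cases "\<bar>x\<bar> \<le> e")
  case True
  moreover have "0 \<le> x ^ 4 / e ^ 3" using assms by simp
  ultimately show ?thesis by linarith
next
  case False
  then have "\<bar>x\<bar> * e ^ 3 \<le> \<bar>x\<bar> * \<bar>x\<bar> ^ 3"
    using assms by (intro mult_left_mono power_mono) simp_all
  also have "\<dots> = x ^ 4"
    by (simp add: power_even_abs flip: power_Suc)
  finally have "\<bar>x\<bar> \<le> x ^ 4 / e ^ 3" using assms by (simp add: pos_le_divide_eq)
  then show ?thesis using assms by linarith
qed

context
  fixes M :: "'a measure" and X :: "real \<Rightarrow> 'a \<Rightarrow> real" and K :: real
  assumes X: "continuous_gaussian_process M X" and K: "variogram_bound K M X"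
begin

text \<open>Dominates the fourth power of every increment at level j, and thus stands in for their
  maximum.\<close>

definition increment_power_sum :: "nat \<Rightarrow> nat \<Rightarrow> 'a \<Rightarrow> real" where
  "increment_power_sum n j \<omega> =
     (\<Sum>i<Suc n * 2 ^ j. (X (real (Suc i) / 2 ^ j) \<omega> - X (real i / 2 ^ j) \<omega>) ^ 4)"

text \<open>There are (n + 1) 2^j increments, each with fourth moment at most 3 K^2 4^-j.\<close>

lemma increment_power_sum_bound:
  shows "integrable M (increment_power_sum n j)"
    and "(LINT \<omega>|M. increment_power_sum n j \<omega>) \<le> 3 * K\<^sup>2 * real (Suc n) * (1/2) ^ j"
proof -
  have le: "real i / 2 ^ j \<le> real (Suc i) / 2 ^ j" for i by (simp add: divide_right_mono)
  have len: "real (Suc i) / 2 ^ j - real i / 2 ^ j = (1/2) ^ j" for i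
    by (simp add: field_simps power_divide)
  note m = increment_fourth_moment[OF X K _ le]
  show int: "integrable M (increment_power_sum n j)"
    unfolding increment_power_sum_def[abs_def]
    by (intro Bochner_Integration.integrable_sum m(1)) simp
  have "(LINT \<omega>|M. increment_power_sum n j \<omega>) =
      (\<Sum>i<Suc n * 2 ^ j. LINT \<omega>|M. (X (real (Suc i) / 2 ^ j) \<omega> - X (real i / 2 ^ j) \<omega>) ^ 4)"
    unfolding increment_power_sum_def
    by (intro Bochner_Integration.integral_sum m(1)) simp
  also have "\<dots> \<le> (\<Sum>i<Suc n * 2 ^ j. 3 * (K * (1/2) ^ j)\<^sup>2)"
    using m(2) unfolding len by (intro sum_mono) simp
  also have "\<dots> = 3 * K\<^sup>2 * real (Suc n) * (2 ^ j * ((1/2) ^ j * (1/2) ^ j))"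
    by (simp add: power2_eq_square algebra_simps)
  also have "(2::real) ^ j * ((1/2) ^ j * (1/2) ^ j) = (1/2) ^ j"
    by (simp flip: power_mult_distrib mult.assoc)
  finally show "(LINT \<omega>|M. increment_power_sum n j \<omega>) \<le> 3 * K\<^sup>2 * real (Suc n) * (1/2) ^ j" .
qed

text \<open>The deterministic step estimate is applied with random bounds for the increments. The
  factor 3 adds the weights 1 and 2 of the coarse and the fine level in
  \<open>hat_interp_step\<close>.\<close>

lemma hat_interp_integral_step:
  assumes g: "lipschitz_upto n g" and b: "\<And>x. \<bar>g x\<bar> \<le> b"
  shows "\<bar>(LINT \<omega>|M. g (hat_interp n (Suc j) (samples (Suc j) (path_of X \<omega>)))) -
      (LINT \<omega>|M. g (hat_interp n j (samples j (path_of X \<omega>))))\<bar>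
      \<le> 3 * real n * (1 + 3 * K\<^sup>2 * real (Suc n)) * (9/10) ^ j"
proof -
  interpret prob_space M using X by (rule process_prob_space)
  (* The threshold q^j for the increments at level j must be summable, while the fourth moment
     bound (1/2)^j / (q^j)^3 must stay below q^j; any q < 1 with q^4 >= 1/2 does. *)
  define q :: real where "q = 9 / 10"
  have q: "0 < q ^ j" by (simp add: q_def)
  \<comment> \<open>The threshold stays at q^j for both levels l = j and l = j + 1, so that one
    estimate covers both.\<close>
  define d where "d l \<omega> = q ^ j + increment_power_sum n l \<omega> / (q ^ j) ^ 3" for l \<omega>
  define a where "a l \<omega> = g (hat_interp n l (samples l (path_of X \<omega>)))" for l \<omega>
  have inc: "\<bar>samples l (path_of X \<omega>) (Suc i) - samples l (path_of X \<omega>) i\<bar> \<le> d l \<omega>"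
    if "\<omega> \<in> space M" "Suc i \<le> Suc n * 2 ^ l" for l i \<omega>
  proof -
    let ?D = "\<lambda>i. X (real (Suc i) / 2 ^ l) \<omega> - X (real i / 2 ^ l) \<omega>"
    have "?D i ^ 4 \<le> increment_power_sum n l \<omega>"
      unfolding increment_power_sum_def
      by (rule member_le_sum[where f = "\<lambda>i. ?D i ^ 4"]) (use that(2) in simp_all)
    then have "?D i ^ 4 / (q ^ j) ^ 3 \<le> increment_power_sum n l \<omega> / (q ^ j) ^ 3"
      using q by (intro divide_right_mono) simp_all
    then have "\<bar>?D i\<bar> \<le> d l \<omega>"
      using abs_le_plus_power4[OF q, of "?D i"] unfolding d_def by linarith
    then show ?thesis by (simp only: samples_path_of[OF X that(1)])
  qed
  have diff: "\<bar>a (Suc j) \<omega> - a j \<omega>\<bar> \<le> real n * (d j \<omega> + 2 * d (Suc j) \<omega>)" if "\<omega> \<in> space M" for \<omega>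
  proof -
    have "close_upto n (d j \<omega> + 2 * d (Suc j) \<omega>) (hat_interp n (Suc j) (samples (Suc j) (path_of X \<omega>)))
           (hat_interp n j (samples j (path_of X \<omega>)))"
      by (rule hat_interp_step) (rule inc[OF that], assumption)+
    then show ?thesis using g unfolding lipschitz_upto_def a_def by blast
  qed
  have ia: "integrable M (a l)" for l
  proof (rule integrable_const_bound[where B = b])
    show "AE \<omega> in M. norm (a l \<omega>) \<le> b" using b by (simp add: a_def)
    have "(\<lambda>\<omega>. samples l (path_of X \<omega>)) \<in> borel_measurable M"
      using gaussian_vector_samples[OF X, of 0 l] by (simp add: gaussian_vector_def)
    then show "a l \<in> borel_measurable M"
      unfolding a_def
      by (rule measurable_compose)
         (intro borel_measurable_continuous_onI continuous_lipschitz_hat_interp g)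
  qed
  have id: "integrable M (d l)" for l
    unfolding d_def using increment_power_sum_bound(1)[of n l] by simp
  have geo: "(1/2) ^ j / (q ^ j) ^ 3 \<le> q ^ j"
  proof -
    have "(1/2) ^ j \<le> (q * q ^ 3) ^ j" by (intro power_mono) (simp_all add: q_def power3_eq_cube)
    also have "\<dots> = q ^ j * (q ^ j) ^ 3"
      by (simp add: power_mult_distrib flip: power_mult) (simp add: mult.commute)
    finally show ?thesis using q by (simp add: divide_le_eq)
  qed
  have Ed: "(LINT \<omega>|M. d l \<omega>) \<le> (1 + 3 * K\<^sup>2 * real (Suc n)) * q ^ j" if "j \<le> l" for l
  proof -
    have "(LINT \<omega>|M. d l \<omega>) = q ^ j + (LINT \<omega>|M. increment_power_sum n l \<omega>) / (q ^ j) ^ 3"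
      unfolding d_def using increment_power_sum_bound(1)[of n l] by (simp add: prob_space)
    also have "\<dots> \<le> q ^ j + 3 * K\<^sup>2 * real (Suc n) * (1/2) ^ l / (q ^ j) ^ 3"
      using increment_power_sum_bound(2)[of n l] q
      by (intro add_left_mono divide_right_mono) simp_all
    also have "\<dots> \<le> q ^ j + 3 * K\<^sup>2 * real (Suc n) * (1/2) ^ j / (q ^ j) ^ 3"
      using q that by (intro add_left_mono divide_right_mono mult_left_mono power_decreasing) simp_all
    also have "\<dots> = q ^ j + 3 * K\<^sup>2 * real (Suc n) * ((1/2) ^ j / (q ^ j) ^ 3)" by simp
    also have "\<dots> \<le> q ^ j + 3 * K\<^sup>2 * real (Suc n) * q ^ j"
      using geo by (intro add_left_mono mult_left_mono) simp_all
    finally show ?thesis by (simp add: algebra_simps)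
  qed
  have "\<bar>(LINT \<omega>|M. a (Suc j) \<omega>) - (LINT \<omega>|M. a j \<omega>)\<bar> = \<bar>LINT \<omega>|M. a (Suc j) \<omega> - a j \<omega>\<bar>"
    using ia by simp
  also have "\<dots> \<le> (LINT \<omega>|M. real n * (d j \<omega> + 2 * d (Suc j) \<omega>))"
    using ia id diff by (intro integral_abs_le) simp_all
  also have "\<dots> = real n * ((LINT \<omega>|M. d j \<omega>) + 2 * (LINT \<omega>|M. d (Suc j) \<omega>))"
    using id by simp
  also have "\<dots> \<le> real n * (3 * ((1 + 3 * K\<^sup>2 * real (Suc n)) * q ^ j))"
    using Ed[of j] Ed[of "Suc j"] by (intro mult_left_mono) simp_all
  finally show ?thesis unfolding a_def q_def by (simp only: mult_ac)
qed

text \<open>Sums the geometric steps. The process enters the bound only through K, so one level j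
  works for a whole family with a common variogram bound.\<close>

lemma hat_interp_integral_close:
  assumes g: "lipschitz_upto n g" and b: "\<And>x. \<bar>g x\<bar> \<le> b"
  shows "\<bar>(LINT \<omega>|M. g (path_of X \<omega>)) -
      (LINT \<omega>|M. g (hat_interp n j (samples j (path_of X \<omega>))))\<bar>
      \<le> 3 * real n * (1 + 3 * K\<^sup>2 * real (Suc n)) * (9/10) ^ j / (1 - 9/10)"
proof (rule geometric_tail_bound)
  interpret prob_space M using X by (rule process_prob_space)
  show "(\<lambda>j. LINT \<omega>|M. g (hat_interp n j (samples j (path_of X \<omega>)))) \<longlonglongrightarrow>
      (LINT \<omega>|M. g (path_of X \<omega>))"
  proof (rule integral_dominated_convergence[where w = "\<lambda>_. b"])
    show "AE \<omega> in M. (\<lambda>j. g (hat_interp n j (samples j (path_of X \<omega>)))) \<longlonglongrightarrow> g (path_of X \<omega>)"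
      by (intro AE_I2 lipschitz_hat_interp_tendsto[OF g])
    show "(\<lambda>\<omega>. g (path_of X \<omega>)) \<in> borel_measurable M"
      using path_of_measurable[OF X] borel_measurable_lipschitz_upto[OF g] by (rule measurable_compose)
    show "(\<lambda>\<omega>. g (hat_interp n j (samples j (path_of X \<omega>)))) \<in> borel_measurable M" for j
    proof -
      have "(\<lambda>\<omega>. samples j (path_of X \<omega>)) \<in> borel_measurable M"
        using gaussian_vector_samples[OF X, of 0 j] by (simp add: gaussian_vector_def)
      then show ?thesis
        by (rule measurable_compose)
           (intro borel_measurable_continuous_onI continuous_lipschitz_hat_interp g)
    qed
  qed (simp_all add: b)
qed (use hat_interp_integral_step[OF g b] in simp_all)

end

theorem gaussian_process_weak_conv:
  fixes X :: "'i \<Rightarrow> real \<Rightarrow> 'a \<Rightarrow> real" and Y :: "real \<Rightarrow> 'b \<Rightarrow> real"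
  assumes X: "\<forall>\<^sub>F i in F. continuous_gaussian_process (M i) (X i) \<and> variogram_bound K (M i) (X i)"
    and Y: "continuous_gaussian_process N Y" "variogram_bound K N Y"
    and cov: "\<And>s t. 0 \<le> s \<Longrightarrow> s \<le> t \<Longrightarrow>
      ((\<lambda>i. LINT \<omega>|M i. X i s \<omega> * X i t \<omega>) \<longlongrightarrow> (LINT \<omega>|N. Y s \<omega> * Y t \<omega>)) F"
  shows "weak_conv_to (\<lambda>i. path_law (M i) (X i)) (path_law N Y) F"
proof (rule weak_conv_to_lipschitz)
  show "\<forall>\<^sub>F i in F. prob_space (path_law (M i) (X i)) \<and> sets (path_law (M i) (X i)) = sets borel"
    using X by eventually_elim (simp add: prob_space_path_law sets_path_law)
  show "prob_space (path_law N Y)" "sets (path_law N Y) = sets borel"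
    using Y by (simp_all add: prob_space_path_law sets_path_law)
  fix n b and g :: "halfline_path \<Rightarrow> real"
  assume b: "\<And>x. \<bar>g x\<bar> \<le> b" and g: "lipschitz_upto n g"
  note gm = borel_measurable_lipschitz_upto[OF g]
  have "((\<lambda>i. LINT \<omega>|M i. g (path_of (X i) \<omega>)) \<longlongrightarrow> (LINT \<omega>|N. g (path_of Y \<omega>))) F"
  proof (rule tendstoI)
    fix e :: real assume e: "0 < e"
    define \<eta> where "\<eta> j = 3 * real n * (1 + 3 * K\<^sup>2 * real (Suc n)) * (9/10) ^ j / (1 - 9/10)"
      for j :: nat
    have "\<eta> \<longlonglongrightarrow> 3 * real n * (1 + 3 * K\<^sup>2 * real (Suc n)) * 0 / (1 - 9/10)"
      unfolding \<eta>_def by (intro tendsto_intros LIMSEQ_realpow_zero) simp_all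
    then have "\<forall>\<^sub>F j in sequentially. \<eta> j < e / 3"
      by (rule order_tendstoD(2)) (use e in simp)
    \<comment> \<open>The level is fixed before the index i, which is possible because \<eta> does
      not depend on the process. What remains is a statement about Gaussian vectors.\<close>
    then obtain j where j: "\<eta> j < e / 3" by (auto simp: eventually_sequentially)
    have cov': "((\<lambda>i. LINT \<omega>|M i. X i s \<omega> * X i t \<omega>) \<longlongrightarrow> (LINT \<omega>|N. Y s \<omega> * Y t \<omega>)) F"
      if "0 \<le> s" "0 \<le> t" for s t
      using cov[of s t] cov[of t s] that by (cases "s \<le> t") (simp_all add: mult.commute)
    have "((\<lambda>i. LINT \<omega>|M i. g (hat_interp n j (samples j (path_of (X i) \<omega>)))) \<longlongrightarrow>
        (LINT \<omega>|N. g (hat_interp n j (samples j (path_of Y \<omega>))))) F"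
    \<comment> \<open>The interpolation uses the nodes 0 up to \<open>Suc n * 2 ^ j\<close>
      inclusive, hence one coordinate more.\<close>
    proof (rule gaussian_vector_integral_tendsto[where m = "Suc (Suc n * 2 ^ j)"
          and W = "\<lambda>i \<omega>. samples j (path_of (X i) \<omega>)" and V = "\<lambda>\<omega>. samples j (path_of Y \<omega>)"
          and h = "\<lambda>z. g (hat_interp n j z)"])
      show "\<forall>\<^sub>F i in F. gaussian_vector (Suc (Suc n * 2 ^ j)) (M i) (\<lambda>\<omega>. samples j (path_of (X i) \<omega>))"
        using X by eventually_elim (simp add: gaussian_vector_samples)
      show "gaussian_vector (Suc (Suc n * 2 ^ j)) N (\<lambda>\<omega>. samples j (path_of Y \<omega>))"
        using Y by (simp add: gaussian_vector_samples)
      show "continuous_on UNIV (\<lambda>z. g (hat_interp n j z))"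
        using g by (rule continuous_lipschitz_hat_interp)
      show "\<bar>g (hat_interp n j z)\<bar> \<le> b" for z by (rule b)
      show "\<forall>z z'. (\<forall>k<Suc (Suc n * 2 ^ j). z k = z' k) \<longrightarrow> g (hat_interp n j z) = g (hat_interp n j z')"
        by (intro allI impI arg_cong[where f = g] hat_interp_cong) simp
      fix k l
      have "\<forall>\<^sub>F i in F. (LINT \<omega>|M i. X i (real k / 2 ^ j) \<omega> * X i (real l / 2 ^ j) \<omega>) =
          (LINT \<omega>|M i. samples j (path_of (X i) \<omega>) k * samples j (path_of (X i) \<omega>) l)"
        using X by eventually_elim (simp add: integral_samples_mult)
      moreover have "((\<lambda>i. LINT \<omega>|M i. X i (real k / 2 ^ j) \<omega> * X i (real l / 2 ^ j) \<omega>) \<longlongrightarrow>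
          (LINT \<omega>|N. samples j (path_of Y \<omega>) k * samples j (path_of Y \<omega>) l)) F"
        unfolding integral_samples_mult[OF Y(1)] by (intro cov') simp_all
      ultimately show "((\<lambda>i. LINT \<omega>|M i. samples j (path_of (X i) \<omega>) k * samples j (path_of (X i) \<omega>) l) \<longlongrightarrow>
          (LINT \<omega>|N. samples j (path_of Y \<omega>) k * samples j (path_of Y \<omega>) l)) F"
        by (rule Lim_transform_eventually[rotated])
    qed
    then have "\<forall>\<^sub>F i in F. dist (LINT \<omega>|M i. g (hat_interp n j (samples j (path_of (X i) \<omega>))))
        (LINT \<omega>|N. g (hat_interp n j (samples j (path_of Y \<omega>)))) < e / 3"
      by (rule tendstoD) (use e in simp)
    with X show "\<forall>\<^sub>F i in F. dist (LINT \<omega>|M i. g (path_of (X i) \<omega>)) (LINT \<omega>|N. g (path_of Y \<omega>)) < e"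
    proof eventually_elim
      case (elim i)
      have "\<bar>(LINT \<omega>|M i. g (path_of (X i) \<omega>)) -
          (LINT \<omega>|M i. g (hat_interp n j (samples j (path_of (X i) \<omega>))))\<bar> \<le> \<eta> j"
        unfolding \<eta>_def using elim g b by (intro hat_interp_integral_close) simp_all
      moreover have "\<bar>(LINT \<omega>|N. g (path_of Y \<omega>)) -
          (LINT \<omega>|N. g (hat_interp n j (samples j (path_of Y \<omega>))))\<bar> \<le> \<eta> j"
        unfolding \<eta>_def using Y g b by (intro hat_interp_integral_close) simp_all
      ultimately show ?case using elim(2) j unfolding dist_real_def by linarith
    qed
  qed
  moreover have "\<forall>\<^sub>F i in F. (LINT \<omega>|M i. g (path_of (X i) \<omega>)) = integral\<^sup>L (path_law (M i) (X i)) g"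
    using X by eventually_elim (simp add: integral_path_law gm)
  ultimately show "((\<lambda>i. integral\<^sup>L (path_law (M i) (X i)) g) \<longlongrightarrow> integral\<^sup>L (path_law N Y) g) F"
    unfolding integral_path_law[OF Y(1) gm] by (rule Lim_transform_eventually)
qed

subsection \<open>The rescaled covariance kernel\<close>

(* The continuous extension to d = 0 of (1 - r^d) / d, i.e. the integral of u^(d - 1) over [r, 1]. *)
definition power_gap :: "real \<Rightarrow> real \<Rightarrow> real" where
  "power_gap r d = (if d = 0 then - ln r else (1 - r powr d) / d)"

text \<open>It is the integral of a positive function over [r, 1]; the proof checks the sign of d
  instead.\<close>

lemma power_gap_nonneg:
  assumes "0 < r" "r \<le> 1"
  shows "0 \<le> power_gap r d"
proof -
  consider "d = 0" | "0 < d" | "d < 0" by linarith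
  then show ?thesis
  proof cases
    case 2
    then have "r powr d \<le> 1" using assms by (intro powr_le1) simp_all
    with 2 show ?thesis by (simp add: power_gap_def)
  next
    case 3
    have "1 powr d \<le> r powr d" using assms 3 by (intro powr_mono2') simp_all
    with 3 show ?thesis by (simp add: power_gap_def divide_nonpos_neg)
  qed (use assms in \<open>simp add: power_gap_def\<close>)
qed

text \<open>At d = 0 the value is minus the derivative of r^x in x at 0; elsewhere it is a quotient
  of continuous functions.\<close>

lemma isCont_power_gap:
  assumes r: "0 < r"
  shows "isCont (power_gap r) d"
proof (cases "d = 0")
  case True
  have "((\<lambda>x. r powr x) has_real_derivative ln r) (at 0)"
    using r by (auto intro!: derivative_eq_intros)
  then have "((\<lambda>x. - ((r powr x - 1) / x)) \<longlongrightarrow> - ln r) (at 0)"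
    using r unfolding DERIV_def by (intro tendsto_minus) simp
  moreover have "\<forall>\<^sub>F x in at 0. - ((r powr x - 1) / x) = power_gap r x"
    by (auto simp: eventually_at_filter power_gap_def minus_divide_left)
  ultimately have "(power_gap r \<longlongrightarrow> - ln r) (at 0)"
    by (rule Lim_transform_eventually)
  then show ?thesis using True by (simp add: isCont_def power_gap_def)
next
  case False
  have "((\<lambda>x. (1 - r powr x) / x) \<longlongrightarrow> (1 - r powr d) / d) (at d)"
    using False r by (intro tendsto_intros) auto
  moreover have "\<forall>\<^sub>F x in at d. (1 - r powr x) / x = power_gap r x"
  proof -
    have "\<forall>\<^sub>F x in at d. x \<noteq> 0"
      using False tendsto_imp_eventually_ne[of "\<lambda>x. x" d "at d" 0] by simp
    then show ?thesis by eventually_elim (simp add: power_gap_def)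
  qed
  ultimately have "(power_gap r \<longlongrightarrow> (1 - r powr d) / d) (at d)"
    by (rule Lim_transform_eventually)
  then show ?thesis using False by (simp add: isCont_def power_gap_def)
qed

text \<open>What 2(1-p)(\<gamma>+1) - 1 times \<open>cov_kernel\<close> becomes after cancellation.
  For s > 0 the only explicit denominator left that depends on p is 1 - p, so the formula makes
  sense at p_hat, at p_crit and beyond.\<close>

definition rescaled_kernel :: "real \<Rightarrow> real \<Rightarrow> real \<Rightarrow> real \<Rightarrow> real" where
  "rescaled_kernel \<gamma> p s t = (if s = 0 then 0 else
     s / (1 - p) * (2 * \<gamma> + 1 - p +
       p * ((2 - p) * (\<gamma> + 1) - 1) * power_gap (s / t) (\<gamma> - p * (\<gamma> + 1))))"

lemma isCont_rescaled_kernel: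
  assumes "p < 1" "0 \<le> s" "s \<le> t"
  shows "isCont (\<lambda>p. rescaled_kernel \<gamma> p s t) p"
proof (cases "s = 0")
  case False
  have "isCont (\<lambda>p. power_gap (s / t) (\<gamma> - p * (\<gamma> + 1))) p"
    using False assms by (intro isCont_o2[OF _ isCont_power_gap] continuous_intros) simp_all
  with False assms show ?thesis
    unfolding rescaled_kernel_def by (auto intro!: continuous_intros)
qed (simp add: rescaled_kernel_def)

section \<open>The kernel for \<gamma> > -1/2: cancellation, critical value and increments\<close>

context
  fixes \<gamma> :: real
  assumes \<gamma>: "- 1 / 2 < \<gamma>"
begin

lemma p_crit_bounds: "0 < p_crit \<gamma>" "p_crit \<gamma> < 1"
  using \<gamma> by (simp_all add: p_crit_def divide_less_eq)

lemma p_crit_iff: "p < p_crit \<gamma> \<longleftrightarrow> 0 < 2 * (1 - p) * (\<gamma> + 1) - 1"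
  using \<gamma> by (simp add: p_crit_def field_simps)

lemma rescaled_kernel_eq:
  assumes p: "p < p_crit \<gamma>"
  shows "(2 * (1 - p) * (\<gamma> + 1) - 1) * cov_kernel \<gamma> p s t = rescaled_kernel \<gamma> p s t"
proof (cases "s = 0")
  case False
  define \<delta> where "\<delta> = \<gamma> - p * (\<gamma> + 1)"
  define R where "R = (s / t) powr \<delta>"
  have p1: "p < 1" using p p_crit_bounds by linarith
  have hat: "p = p_hat \<gamma> \<longleftrightarrow> \<delta> = 0"
    using \<gamma> by (auto simp: p_hat_def \<delta>_def field_simps)
  show ?thesis
  proof (cases "\<delta> = 0")
    case True
    have "p = p_hat \<gamma>" using True hat by simp
    then have g: "\<gamma> = p / (1 - p)" using \<gamma> p1 by (simp add: p_hat_def field_simps)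
    have g1: "\<gamma> + 1 = 1 / (1 - p)" using p1 by (simp add: g field_simps)
    let ?L = "ln (s / t)" and ?A = "2 * \<gamma> + 1 - p" and ?B = "p * ((2 - p) * (\<gamma> + 1) - 1)"
    \<comment> \<open>At p_hat, (1 - p)(\<gamma> + 1) = 1, so the rescaling is trivial and the
      logarithmic formula has to come out unchanged.\<close>
    have c: "2 * (1 - p) * (\<gamma> + 1) - 1 = 1"
      using True unfolding \<delta>_def by (simp add: algebra_simps)
    have B: "?B / (1 - p) = \<gamma> * (\<gamma> + 1)"
      using p1 by (simp add: g1) (simp add: g field_simps)
    have A: "?A / (1 - p) = \<gamma>\<^sup>2 + (\<gamma> + 1)\<^sup>2"
      using p1 by (simp add: g1, simp add: g field_simps power2_eq_square, simp add: add_divide_distrib)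
    have "rescaled_kernel \<gamma> p s t = s / (1 - p) * (?A + ?B * - ?L)"
      using False True by (simp add: rescaled_kernel_def power_gap_def \<delta>_def)
    also have "\<dots> = s * (?A / (1 - p) + ?B / (1 - p) * - ?L)"
      by (simp only: distrib_left add_divide_distrib times_divide_eq_left times_divide_eq_right)
    also have "\<dots> = cov_kernel \<gamma> p s t"
      unfolding A B using False \<open>p = p_hat \<gamma>\<close> by (simp add: cov_kernel_def)
    finally show ?thesis unfolding c by simp
  next
    case d: False
    let ?c = "2 * (1 - p) * (\<gamma> + 1) - 1" and ?B = "p * ((2 - p) * (\<gamma> + 1) - 1)"
    have c: "?c \<noteq> 0" using p by (simp add: p_crit_iff)
    \<comment> \<open>This factorization supplies the \<delta> that cancels the pole at
      p_hat.\<close>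
    have "?c * \<gamma> - ?B = \<delta> * (2 * \<gamma> + 1 - p)"
      unfolding \<delta>_def by (simp add: algebra_simps power2_eq_square)
    then have eq: "?c * \<gamma> - ?B * R = \<delta> * (2 * \<gamma> + 1 - p) + ?B * (1 - R)"
      by (simp add: algebra_simps)
    have "?c * cov_kernel \<gamma> p s t = s / ((1 - p) * \<delta>) * (?c * (\<gamma> - ?B / ?c * R))"
      using False d hat by (simp add: cov_kernel_def R_def flip: \<delta>_def)
    also have "?c * (\<gamma> - ?B / ?c * R) = ?c * \<gamma> - ?B * R"
      using c by (simp add: right_diff_distrib)
    also have "s / ((1 - p) * \<delta>) * (?c * \<gamma> - ?B * R) = s / (1 - p) * (2 * \<gamma> + 1 - p + ?B * ((1 - R) / \<delta>))"
      unfolding eq using d p1 by (simp add: field_simps)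
    also have "\<dots> = rescaled_kernel \<gamma> p s t"
      using False d by (simp add: rescaled_kernel_def power_gap_def R_def flip: \<delta>_def)
    finally show ?thesis .
  qed
qed (simp add: cov_kernel_def rescaled_kernel_def)

text \<open>At p_crit the exponent is -1/2 and 2\<gamma> + 1 - p = 2B, so the constant term cancels
  against the -1 of \<open>power_gap\<close>. A pure power of s/t remains, and the kernel factorizes
  into a function of s times a function of t, as for a single random variable with a deterministic
  factor.\<close>

lemma rescaled_kernel_p_crit:
  assumes "0 \<le> s" "s \<le> t"
  shows "rescaled_kernel \<gamma> (p_crit \<gamma>) s t = (2 * \<gamma> + 1)\<^sup>2 * (sqrt s * sqrt t)"
proof (cases "s = 0")
  case False
  then have s: "0 < s" "0 < t" using assms by simp_all
  let ?p = "p_crit \<gamma>"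
  let ?B = "?p * ((2 - ?p) * (\<gamma> + 1) - 1)"
  have pg: "?p * (\<gamma> + 1) = \<gamma> + 1 / 2" using \<gamma> by (simp add: p_crit_def)
  have p1: "1 - ?p = 1 / (2 * (\<gamma> + 1))" using \<gamma> by (simp add: p_crit_def field_simps)
  have B: "?B = (\<gamma> + 1 / 2)\<^sup>2 / (\<gamma> + 1)"
  proof -
    have "(2 - ?p) * (\<gamma> + 1) - 1 = \<gamma> + 1 / 2" using pg by (simp add: left_diff_distrib)
    then show ?thesis by (simp add: p_crit_def power2_eq_square)
  qed
  have two: "2 * \<gamma> + 1 - ?p = 2 * ?B"
    unfolding B using \<gamma> by (simp add: p_crit_def field_simps power2_eq_square)
  have "power_gap (s / t) (\<gamma> - ?p * (\<gamma> + 1)) = 2 * ((s / t) powr (- (1 / 2)) - 1)"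
    unfolding pg by (simp add: power_gap_def)
  also have "(s / t) powr (- (1 / 2)) = sqrt t / sqrt s"
    using s by (simp add: powr_minus powr_half_sqrt real_sqrt_divide)
  finally have "rescaled_kernel \<gamma> ?p s t = s / (1 - ?p) * (2 * ?B + ?B * (2 * (sqrt t / sqrt s - 1)))"
    using False by (simp add: rescaled_kernel_def two)
  also have "\<dots> = s * (2 * (\<gamma> + 1)) * (2 * ?B * (sqrt t / sqrt s))"
    unfolding p1 by (simp add: algebra_simps)
  also have "\<dots> = (4 * ((\<gamma> + 1) * ?B)) * (s / sqrt s * sqrt t)" by simp
  also have "4 * ((\<gamma> + 1) * ?B) = (2 * \<gamma> + 1)\<^sup>2"
  proof -
    have "(\<gamma> + 1) * ?B = (\<gamma> + 1 / 2)\<^sup>2" unfolding B using \<gamma> by simp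
    then show ?thesis by (simp add: power2_eq_square algebra_simps)
  qed
  finally show ?thesis using s by (simp add: real_div_sqrt)
qed (simp add: rescaled_kernel_def)

text \<open>The diagonal is linear, u * D, and the entry at (s, t) is at least s * D because B and
  \<open>power_gap\<close> are nonnegative. Hence the increment has variance at most (t - s) * D,
  and D is bounded uniformly in p.\<close>

lemma rescaled_kernel_variogram:
  assumes p: "0 \<le> p" "p < p_crit \<gamma>" and st: "0 \<le> s" "s \<le> t"
  shows "rescaled_kernel \<gamma> p t t - 2 * rescaled_kernel \<gamma> p s t + rescaled_kernel \<gamma> p s s
    \<le> 2 * (\<gamma> + 1) * (2 * \<gamma> + 1) * (t - s)"
proof -
  have p1: "p < 1" using p p_crit_bounds by linarith
  have c: "1 < 2 * (1 - p) * (\<gamma> + 1)" using p by (simp add: p_crit_iff)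
  define B where "B = p * ((2 - p) * (\<gamma> + 1) - 1)"
  \<comment> \<open>Sign of B: (2 - p)(\<gamma> + 1) \<ge> (2 - 2p)(\<gamma> + 1) > 1 below
    p_crit.\<close>
  have "1 * (\<gamma> + 1) \<le> (2 - p) * (\<gamma> + 1)" "1 < (2 - 2 * p) * (\<gamma> + 1)"
    using \<gamma> p1 c by (auto intro!: mult_right_mono simp: algebra_simps)
  moreover have "(2 - 2 * p) * (\<gamma> + 1) \<le> (2 - p) * (\<gamma> + 1)"
    using \<gamma> p by (intro mult_right_mono) simp_all
  ultimately have B: "0 \<le> B" unfolding B_def using p by simp
  define D where "D = (2 * \<gamma> + 1 - p) / (1 - p)"
  have diag: "rescaled_kernel \<gamma> p u u = u * D" for u
    by (simp add: rescaled_kernel_def power_gap_def D_def)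
  have off: "s * D \<le> rescaled_kernel \<gamma> p s t"
  proof (cases "s = 0")
    case False
    then have "0 \<le> power_gap (s / t) (\<gamma> - p * (\<gamma> + 1))"
      using st by (intro power_gap_nonneg) simp_all
    then show ?thesis
      using False B p1 st
      by (simp add: rescaled_kernel_def D_def divide_right_mono mult_left_mono flip: B_def)
  qed (simp add: rescaled_kernel_def)
  have "rescaled_kernel \<gamma> p t t - 2 * rescaled_kernel \<gamma> p s t + rescaled_kernel \<gamma> p s s
      \<le> (t - s) * D"
    using off unfolding diag by (simp add: algebra_simps)
  also have "\<dots> \<le> (t - s) * (2 * (\<gamma> + 1) * (2 * \<gamma> + 1))"
  proof (rule mult_left_mono)
    \<comment> \<open>Below p_crit, 1 / (1 - p) < 2(\<gamma> + 1); this is the origin of the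
      constant.\<close>
    have "2 * \<gamma> + 1 - p \<le> 1 * (2 * \<gamma> + 1)" using p by simp
    also have "\<dots> \<le> (2 * (1 - p) * (\<gamma> + 1)) * (2 * \<gamma> + 1)"
      using c \<gamma> by (intro mult_right_mono) simp_all
    also have "\<dots> = 2 * (\<gamma> + 1) * (2 * \<gamma> + 1) * (1 - p)" by (simp only: mult_ac)
    finally show "D \<le> 2 * (\<gamma> + 1) * (2 * \<gamma> + 1)"
      unfolding D_def using p1 by (subst pos_divide_le_eq) simp_all
  qed (use st in simp)
  finally show ?thesis by (simp add: mult_ac)
qed

section \<open>The rescaled process and its limit at p_crit\<close>

lemma rescaled_process_covariance:
  assumes G: "is_G_process \<gamma> p M X" and p: "p < p_crit \<gamma>" and st: "0 \<le> s" "s \<le> t"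
  shows "(LINT \<omega>|M. rescaled_process \<gamma> p X s \<omega> * rescaled_process \<gamma> p X t \<omega>) = rescaled_kernel \<gamma> p s t"
proof -
  let ?c = "2 * (1 - p) * (\<gamma> + 1) - 1"
  have "0 \<le> ?c" using p by (simp add: p_crit_iff)
  then have "rescaled_process \<gamma> p X s \<omega> * rescaled_process \<gamma> p X t \<omega> = ?c * (X s \<omega> * X t \<omega>)" for \<omega>
    using real_sqrt_mult_self[of ?c] unfolding rescaled_process_def
    by (metis abs_of_nonneg mult.commute mult.left_commute)
  then have "(LINT \<omega>|M. rescaled_process \<gamma> p X s \<omega> * rescaled_process \<gamma> p X t \<omega>) = ?c * cov_kernel \<gamma> p s t"
    using G st by (simp add: is_G_process_def)
  then show ?thesis by (simp only: rescaled_kernel_eq[OF p])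
qed

lemma rescaled_process_gaussian:
  assumes G: "is_G_process \<gamma> p M X"
  shows "continuous_gaussian_process M (rescaled_process \<gamma> p X)"
proof -
  let ?a = "sqrt (2 * (1 - p) * (\<gamma> + 1) - 1)"
  have X: "centered_gaussian_process M X" and cont: "\<And>\<omega>. \<omega> \<in> space M \<Longrightarrow> continuous_on {0..} (\<lambda>t. X t \<omega>)"
    using G by (simp_all add: is_G_process_def)
  have "centered_gaussian M (\<lambda>\<omega>. \<Sum>t\<in>I. c t * rescaled_process \<gamma> p X t \<omega>)"
    if "finite I" "I \<subseteq> {0..}" for I c
  proof -
    have "centered_gaussian M (\<lambda>\<omega>. \<Sum>t\<in>I. (c t * ?a) * X t \<omega>)"
      using X[unfolded centered_gaussian_process_def] that
      by (elim conjE allE[of _ I] allE[of _ "\<lambda>t. c t * ?a"]) simp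
    then show ?thesis by (simp add: rescaled_process_def mult.assoc)
  qed
  then show ?thesis
    using X cont unfolding continuous_gaussian_process_def centered_gaussian_process_def
    by (auto simp: rescaled_process_def[abs_def] intro!: continuous_intros)
qed

lemma rescaled_process_variogram:
  assumes G: "is_G_process \<gamma> p M X" and p: "0 \<le> p" "p < p_crit \<gamma>"
  shows "variogram_bound (2 * (\<gamma> + 1) * (2 * \<gamma> + 1)) M (rescaled_process \<gamma> p X)"
  unfolding variogram_bound_def
proof (intro allI impI, elim conjE)
  fix s t :: real assume st: "0 \<le> s" "s \<le> t"
  let ?R = "rescaled_process \<gamma> p X"
  note R = rescaled_process_gaussian[OF G]
  have t: "0 \<le> t" using st by simp
  have sq: "integrable M (\<lambda>\<omega>. (?R u \<omega>)\<^sup>2)" if "0 \<le> u" for u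
  proof -
    have "centered_gaussian M (\<lambda>\<omega>. \<Sum>v\<in>{u}. 1 * ?R v \<omega>)"
      by (rule process_gaussian[OF R]) (use that in simp_all)
    then show ?thesis using centered_gaussian_moments(1)[OF process_prob_space[OF R]] by simp
  qed
  have prod: "integrable M (\<lambda>\<omega>. ?R s \<omega> * ?R t \<omega>)"
    using st t by (intro integrable_mult_squares sq process_measurable[OF R])
  have "(LINT \<omega>|M. (?R t \<omega> - ?R s \<omega>)\<^sup>2) =
      (LINT \<omega>|M. (?R t \<omega>)\<^sup>2 - 2 * (?R s \<omega> * ?R t \<omega>) + (?R s \<omega>)\<^sup>2)"
    by (intro Bochner_Integration.integral_cong refl) (simp add: power2_diff algebra_simps)
  also have "\<dots> = (LINT \<omega>|M. (?R t \<omega>)\<^sup>2) - 2 * (LINT \<omega>|M. ?R s \<omega> * ?R t \<omega>) + (LINT \<omega>|M. (?R s \<omega>)\<^sup>2)"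
    using sq[OF t] sq[OF st(1)] prod by simp
  also have "\<dots> = rescaled_kernel \<gamma> p t t - 2 * rescaled_kernel \<gamma> p s t + rescaled_kernel \<gamma> p s s"
    using st t by (simp add: power2_eq_square rescaled_process_covariance[OF G p(2)])
  also have "\<dots> \<le> 2 * (\<gamma> + 1) * (2 * \<gamma> + 1) * (t - s)"
    by (rule rescaled_kernel_variogram[OF p st])
  finally show "(LINT \<omega>|M. (?R t \<omega> - ?R s \<omega>)\<^sup>2) \<le> \<dots>" .
qed

lemma sqrt_gaussian_process:
  assumes N: "prob_space N" and Z: "distributed N lborel Z std_normal_density"
  defines "Y \<equiv> \<lambda>t \<omega>. sqrt t * (2 * \<gamma> + 1) * Z \<omega>"
  shows "continuous_gaussian_process N Y"
    and "variogram_bound (2 * (\<gamma> + 1) * (2 * \<gamma> + 1)) N Y"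
    and "0 \<le> s \<Longrightarrow> s \<le> t \<Longrightarrow> (LINT \<omega>|N. Y s \<omega> * Y t \<omega>) = rescaled_kernel \<gamma> (p_crit \<gamma>) s t"
proof -
  interpret N: prob_space N by fact
  have Zm [measurable]: "Z \<in> borel_measurable N"
    using distributed_measurable[OF Z] by simp
  have gauss: "centered_gaussian N (\<lambda>\<omega>. a * Z \<omega>)" for a
  proof (cases "a = 0")
    case False
    then have "distributed N lborel (\<lambda>\<omega>. 0 + a * Z \<omega>) (normal_density (0 + a * 0) (\<bar>a\<bar> * 1))"
      using Z by (intro N.normal_density_affine) simp_all
    then show ?thesis
      using False by (auto simp: centered_gaussian_def intro!: exI[of _ "\<bar>a\<bar>"])
  qed (simp add: centered_gaussian_def)
  have Z2: "(LINT \<omega>|N. (Z \<omega>)\<^sup>2) = 1"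
    using N.standard_normal_distributed_variance[OF Z] N.standard_normal_distributed_expectation[OF Z]
    by simp
  have "centered_gaussian N (\<lambda>\<omega>. \<Sum>t\<in>I. c t * Y t \<omega>)" for I c
    using gauss[of "\<Sum>t\<in>I. c t * (sqrt t * (2 * \<gamma> + 1))"] by (simp add: Y_def sum_distrib_right mult.assoc)
  then show "continuous_gaussian_process N Y"
    unfolding continuous_gaussian_process_def centered_gaussian_process_def
    by (auto simp: Y_def N intro!: continuous_intros)
  show "variogram_bound (2 * (\<gamma> + 1) * (2 * \<gamma> + 1)) N Y"
    unfolding variogram_bound_def
  proof (intro allI impI, elim conjE)
    fix s t :: real assume st: "0 \<le> s" "s \<le> t"
    have "(LINT \<omega>|N. (Y t \<omega> - Y s \<omega>)\<^sup>2) = (LINT \<omega>|N. ((2 * \<gamma> + 1) * (sqrt t - sqrt s))\<^sup>2 * (Z \<omega>)\<^sup>2)"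
    proof (intro Bochner_Integration.integral_cong refl)
      fix \<omega>
      have "Y t \<omega> - Y s \<omega> = (2 * \<gamma> + 1) * (sqrt t - sqrt s) * Z \<omega>"
        by (simp add: Y_def algebra_simps)
      then show "(Y t \<omega> - Y s \<omega>)\<^sup>2 = ((2 * \<gamma> + 1) * (sqrt t - sqrt s))\<^sup>2 * (Z \<omega>)\<^sup>2"
        by (simp only: power_mult_distrib)
    qed
    also have "\<dots> = ((2 * \<gamma> + 1) * (sqrt t - sqrt s))\<^sup>2"
      by (simp add: Z2)
    also have "\<dots> = ((2 * \<gamma> + 1) * (2 * \<gamma> + 1)) * ((sqrt t - sqrt s) * (sqrt t - sqrt s))"
      by (simp add: power2_eq_square)
    \<comment> \<open>Replacing one factor sqrt t - sqrt s by the sum of the roots produces t - s,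
      and 2\<gamma> + 1 \<le> 2(\<gamma> + 1) gives the same constant as below p_crit.\<close>
    also have "\<dots> \<le> (2 * (\<gamma> + 1) * (2 * \<gamma> + 1)) * ((sqrt t - sqrt s) * (sqrt t + sqrt s))"
      using \<gamma> st by (intro mult_mono mult_left_mono mult_right_mono mult_nonneg_nonneg) simp_all
    also have "(sqrt t - sqrt s) * (sqrt t + sqrt s) = t - s"
      using st by (simp add: algebra_simps)
    finally show "(LINT \<omega>|N. (Y t \<omega> - Y s \<omega>)\<^sup>2) \<le> 2 * (\<gamma> + 1) * (2 * \<gamma> + 1) * (t - s)" .
  qed
  assume st: "0 \<le> s" "s \<le> t"
  have "(LINT \<omega>|N. Y s \<omega> * Y t \<omega>) = (LINT \<omega>|N. (2 * \<gamma> + 1)\<^sup>2 * (sqrt s * sqrt t) * (Z \<omega>)\<^sup>2)"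
    unfolding Y_def
    by (intro Bochner_Integration.integral_cong refl) (simp add: power2_eq_square mult_ac)
  then show "(LINT \<omega>|N. Y s \<omega> * Y t \<omega>) = rescaled_kernel \<gamma> (p_crit \<gamma>) s t"
    by (simp add: Z2 rescaled_kernel_p_crit[OF st])
qed

text \<open>Stated for a filter and a point q < 1 so that it covers both an interior p0 and the
  approach to p_crit from the left. In the second case the limit covariance is given by the
  continuous extension of the kernel.\<close>

lemma rescaled_process_weak_conv:
  fixes M :: "real \<Rightarrow> 'a measure" and N :: "'b measure"
  assumes G: "\<And>p. p \<in> {0..<p_crit \<gamma>} \<Longrightarrow> is_G_process \<gamma> p (M p) (G p)"
    and F: "F \<le> at q" "\<forall>\<^sub>F p in F. p \<in> {0..<p_crit \<gamma>}" and q: "q < 1"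
    and Y: "continuous_gaussian_process N Y" "variogram_bound (2 * (\<gamma> + 1) * (2 * \<gamma> + 1)) N Y"
    and cov: "\<And>s t. 0 \<le> s \<Longrightarrow> s \<le> t \<Longrightarrow> (LINT \<omega>|N. Y s \<omega> * Y t \<omega>) = rescaled_kernel \<gamma> q s t"
  shows "weak_conv_to (\<lambda>p. path_law (M p) (rescaled_process \<gamma> p (G p))) (path_law N Y) F"
proof (rule gaussian_process_weak_conv[OF _ Y])
  show "\<forall>\<^sub>F p in F. continuous_gaussian_process (M p) (rescaled_process \<gamma> p (G p)) \<and>
      variogram_bound (2 * (\<gamma> + 1) * (2 * \<gamma> + 1)) (M p) (rescaled_process \<gamma> p (G p))"
    using F(2)
    by eventually_elim (use G rescaled_process_gaussian rescaled_process_variogram in force)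
  fix s t :: real assume st: "0 \<le> s" "s \<le> t"
  have "((\<lambda>p. rescaled_kernel \<gamma> p s t) \<longlongrightarrow> rescaled_kernel \<gamma> q s t) F"
    using isCont_rescaled_kernel[OF q st] F(1) unfolding isCont_def by (rule tendsto_mono[rotated])
  moreover have "\<forall>\<^sub>F p in F. rescaled_kernel \<gamma> p s t =
      (LINT \<omega>|M p. rescaled_process \<gamma> p (G p) s \<omega> * rescaled_process \<gamma> p (G p) t \<omega>)"
    using F(2) by eventually_elim (simp add: rescaled_process_covariance[OF G _ st])
  ultimately show "((\<lambda>p. LINT \<omega>|M p. rescaled_process \<gamma> p (G p) s \<omega> * rescaled_process \<gamma> p (G p) t \<omega>)
      \<longlongrightarrow> (LINT \<omega>|N. Y s \<omega> * Y t \<omega>)) F"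
    unfolding cov[OF st] by (rule Lim_transform_eventually)
qed

end

theorem proposition2p20:
  fixes \<gamma> :: real
    and M :: "real \<Rightarrow> 'a measure"
    and G :: "real \<Rightarrow> real \<Rightarrow> 'a \<Rightarrow> real"
  assumes "\<gamma> > - 1 / 2"
    and "\<And>p. p \<in> {0..<p_crit \<gamma>} \<Longrightarrow> is_G_process \<gamma> p (M p) (G p)"
  shows "(\<forall>p0\<in>{0..<p_crit \<gamma>}.
            weak_conv_to (\<lambda>p. path_law (M p) (rescaled_process \<gamma> p (G p)))
              (path_law (M p0) (rescaled_process \<gamma> p0 (G p0)))
              (at p0 within {0..<p_crit \<gamma>})) \<and>
         (\<forall>(\<mu> :: nat \<Rightarrow> real) (N :: 'b measure) Z.
            memory_sequence \<gamma> \<mu> \<and> \<not> bounded (range (mem_v (p_crit \<gamma>) \<mu>)) \<and>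
            prob_space N \<and> distributed N lborel Z std_normal_density \<longrightarrow>
            weak_conv_to (\<lambda>p. path_law (M p) (rescaled_process \<gamma> p (G p)))
              (path_law N (\<lambda>t \<omega>. sqrt t * (2 * \<gamma> + 1) * Z \<omega>)) (at_left (p_crit \<gamma>)))"
proof (intro conjI ballI allI impI, goal_cases)
  case (1 p0)
  then have p0: "0 \<le> p0" "p0 < p_crit \<gamma>" by auto
  note G0 = assms(2)[OF 1]
  show ?case
  proof (rule rescaled_process_weak_conv[OF assms])
    show "at p0 within {0..<p_crit \<gamma>} \<le> at p0" by (rule at_le) simp
    show "\<forall>\<^sub>F p in at p0 within {0..<p_crit \<gamma>}. p \<in> {0..<p_crit \<gamma>}"
      by (auto simp: eventually_at_filter)
    show "p0 < 1" using p0 p_crit_bounds[OF assms(1)] by linarith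
    show "continuous_gaussian_process (M p0) (rescaled_process \<gamma> p0 (G p0))"
      by (rule rescaled_process_gaussian[OF assms(1) G0])
    show "variogram_bound (2 * (\<gamma> + 1) * (2 * \<gamma> + 1)) (M p0) (rescaled_process \<gamma> p0 (G p0))"
      by (rule rescaled_process_variogram[OF assms(1) G0 p0])
    fix s t :: real assume "0 \<le> s" "s \<le> t"
    then show "(LINT \<omega>|M p0. rescaled_process \<gamma> p0 (G p0) s \<omega> * rescaled_process \<gamma> p0 (G p0) t \<omega>) =
        rescaled_kernel \<gamma> p0 s t"
      by (rule rescaled_process_covariance[OF assms(1) G0 p0(2)])
  qed
next
  case (2 \<mu> N Z)
  then have N: "prob_space N" "distributed N lborel Z std_normal_density" by simp_all
  note Y = sqrt_gaussian_process[OF assms(1) N]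
  show ?case
  proof (rule rescaled_process_weak_conv[OF assms])
    show "at_left (p_crit \<gamma>) \<le> at (p_crit \<gamma>)" by (rule at_le) simp
    show "\<forall>\<^sub>F p in at_left (p_crit \<gamma>). p \<in> {0..<p_crit \<gamma>}"
      using eventually_at_left_real[OF p_crit_bounds(1)[OF assms(1)]] by eventually_elim simp
    show "p_crit \<gamma> < 1" by (rule p_crit_bounds(2)[OF assms(1)])
    show "continuous_gaussian_process N (\<lambda>t \<omega>. sqrt t * (2 * \<gamma> + 1) * Z \<omega>)"
      by (rule Y(1))
    show "variogram_bound (2 * (\<gamma> + 1) * (2 * \<gamma> + 1)) N (\<lambda>t \<omega>. sqrt t * (2 * \<gamma> + 1) * Z \<omega>)"
      by (rule Y(2))
    fix s t :: real assume "0 \<le> s" "s \<le> t"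
    then show "(LINT \<omega>|N. sqrt s * (2 * \<gamma> + 1) * Z \<omega> * (sqrt t * (2 * \<gamma> + 1) * Z \<omega>)) =
        rescaled_kernel \<gamma> (p_crit \<gamma>) s t"
      by (rule Y(3))
  qed
qed

end
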